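(* Let $n\ge2$, $\lambda>0$ a constant, $\Omega=\{x\in\mathbb{R}^n:|x|<\lambda\}$, and let $\alpha,\beta\in\mathbb{R}$, $p>1$, $\beta p>1$, $\alpha p\le n+\beta p-1$, $\gamma=\frac{\beta p-1}{p}$, with weights $v,w$ as defined in the context. For every $\varepsilon$ with $0<\varepsilon<1$ there exists $u_\varepsilon\in W^{1,p}_{0,v}(\Omega)$ such that, with $$L(u_\varepsilon)=\int_\Omega v^p|\nabla u_\varepsilon|^p\,dx,\qquad R(u_\varepsilon)=\int_\Omega w^p|u_\varepsilon|^p\,dx,$$ one has $$\gamma^p\ \le\ \frac{L(u_\varepsilon)}{R(u_\varepsilon)}\ \le\ (1+\varepsilon)^p\gamma^p .$$
   Context: Put $k=\frac{n-\alpha p}{\beta p-1}$, $s(x)=\frac{|x|}{\lambda}$, and $g(s)=\frac{1-s^k}{k}$ if $k\ne0$, $g(s)=\ln\frac1s$ if $k=0$. The weights are $v(x)=|x|^{1-\alpha}|g(s(x))|^{1-\beta}$ and $w(x)=|x|^{-\alpha}|g(s(x))|^{-\beta}$. The space $W^{1,p}_{0,v}(\Omega)$ is the completion of $C_0^\infty(\Omega)$ with respect to the norm $\left(\int_\Omega v^p|\nabla u|^p\,dx\right)^{1/p}$. The quotient is understood with $0<R(u_\varepsilon)<\infty$. *)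

theory Defs
  imports "HOL-Analysis.Analysis"
begin

primrec Ck :: "nat \<Rightarrow> ((real^'n) \<Rightarrow> real) \<Rightarrow> bool" where
  "Ck 0 f \<longleftrightarrow> continuous_on UNIV f"
| "Ck (Suc m) f \<longleftrightarrow> f differentiable_on UNIV \<and>
     (\<forall>h. Ck m (\<lambda>x. frechet_derivative f (at x) h))"

definition Cc_infinity :: "(real^'n) set \<Rightarrow> ((real^'n) \<Rightarrow> real) set" where
  "Cc_infinity \<Omega> =
     {f. (\<forall>m. Ck m f) \<and> compact (closure {x. f x \<noteq> 0}) \<and> closure {x. f x \<noteq> 0} \<subseteq> \<Omega>}"

definition grad :: "((real^'n) \<Rightarrow> real) \<Rightarrow> real^'n \<Rightarrow> real^'n" where
  "grad f x = (\<chi> i. frechet_derivative f (at x) (axis i 1))"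

definition weighted_energy ::
    "real \<Rightarrow> (real^'n) set \<Rightarrow> ((real^'n) \<Rightarrow> real) \<Rightarrow> ((real^'n) \<Rightarrow> 'b::real_normed_vector) \<Rightarrow> ennreal" where
  "weighted_energy p \<Omega> v F = (\<integral>\<^sup>+x. ennreal (v x powr p * norm (F x) powr p) \<partial>lebesgue_on \<Omega>)"

text \<open>
  The completion of \<open>Cc_infinity \<Omega>\<close> under the norm
  \<open>(weighted_energy p \<Omega> v (grad \<phi>)) powr (1 / p)\<close> is realised by functions: an element is the almost
  everywhere limit \<open>u\<close> of test functions \<open>\<phi> j\<close> whose gradients converge in the weighted \<open>L\<^sup>p\<close> space,
  and its gradient is the limit \<open>G\<close> of those gradients (the continuous extension of \<open>grad\<close>). For the
  weights \<open>v_weight\<close> below this is the abstract completion: by the Hardy inequality every Cauchy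
  sequence has an almost everywhere convergent subsequence, and a Cauchy sequence tending to \<open>0\<close>
  almost everywhere tends to \<open>0\<close> in norm. In particular \<open>G\<close> is determined by \<open>u\<close> up to null
  sets, and it is the weak gradient of \<open>u\<close> on \<open>\<Omega> - {0}\<close>. On \<open>\<Omega>\<close> itself \<open>u\<close> need not be locally
  integrable, because \<open>v_weight\<close> may vanish to high order at \<open>0\<close>.
\<close>

definition has_W0_gradient ::
    "real \<Rightarrow> (real^'n) set \<Rightarrow> ((real^'n) \<Rightarrow> real) \<Rightarrow> ((real^'n) \<Rightarrow> real) \<Rightarrow> (real^'n \<Rightarrow> real^'n) \<Rightarrow> bool" where
  "has_W0_gradient p \<Omega> v u G \<longleftrightarrow>
     u \<in> borel_measurable (lebesgue_on \<Omega>) \<and> G \<in> borel_measurable (lebesgue_on \<Omega>) \<and>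
     (\<exists>\<phi> :: nat \<Rightarrow> real^'n \<Rightarrow> real.
        (\<forall>j. \<phi> j \<in> Cc_infinity \<Omega>) \<and>
        (AE x in lebesgue_on \<Omega>. (\<lambda>j. \<phi> j x) \<longlonglongrightarrow> u x) \<and>
        (\<lambda>j. weighted_energy p \<Omega> v (\<lambda>x. grad (\<phi> j) x - G x)) \<longlonglongrightarrow> 0)"

definition W0_space ::
    "real \<Rightarrow> (real^'n) set \<Rightarrow> ((real^'n) \<Rightarrow> real) \<Rightarrow> ((real^'n) \<Rightarrow> real) set" where
  "W0_space p \<Omega> v = {u. \<exists>G. has_W0_gradient p \<Omega> v u G}"

definition k_par :: "nat \<Rightarrow> real \<Rightarrow> real \<Rightarrow> real \<Rightarrow> real" where
  "k_par n \<alpha> \<beta> p = (real n - \<alpha> * p) / (\<beta> * p - 1)"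

definition g_fun :: "real \<Rightarrow> real \<Rightarrow> real" where
  "g_fun k s = (if k = 0 then ln (1 / s) else (1 - s powr k) / k)"

definition v_weight :: "real \<Rightarrow> real \<Rightarrow> real \<Rightarrow> real \<Rightarrow> real^'n \<Rightarrow> real" where
  "v_weight \<alpha> \<beta> p lam x =
     norm x powr (1 - \<alpha>) * \<bar>g_fun (k_par CARD('n) \<alpha> \<beta> p) (norm x / lam)\<bar> powr (1 - \<beta>)"

definition w_weight :: "real \<Rightarrow> real \<Rightarrow> real \<Rightarrow> real \<Rightarrow> real^'n \<Rightarrow> real" where
  "w_weight \<alpha> \<beta> p lam x =
     norm x powr (- \<alpha>) * \<bar>g_fun (k_par CARD('n) \<alpha> \<beta> p) (norm x / lam)\<bar> powr (- \<beta>)"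

end

theory Submission
  imports Defs "HOL-Real_Asymp.Real_Asymp"
begin

text \<open>
  Put \<open>\<tau> = s powr (- k) * g s\<close>. For radial functions \<open>U(\<tau>)\<close> both integrals are, up to one common
  constant, those of the one-dimensional Hardy inequality:
  \<open>R = \<integral> \<tau> powr (- \<beta> * p) * \<bar>U\<bar> powr p\<close> and
  \<open>L = \<integral> \<tau> powr ((1 - \<beta>) * p) * \<bar>U'\<bar> powr p\<close>. The boundary of the ball is \<open>\<tau> = 0\<close>, and the near
  extremal behaviour there is \<open>\<tau> powr q\<close> with \<open>q = \<gamma> * (1 + \<epsilon>)\<close>.

  In the variable \<open>t = ln (c / \<tau>)\<close>, which tends to infinity at the boundary, this is \<open>exp (- q * t)\<close>.
  It is made constant near the origin by replacing \<open>t\<close> with \<open>ramp t = t * exp (- 1 / t)\<close>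
  (and \<open>0\<close> for \<open>t \<le> 0\<close>), a smooth function with slope in \<open>[0, 1]\<close> and \<open>ramp t \<ge> t - 1\<close>. Pointwise
  \<open>v\<^sup>p \<bar>grad u\<bar>\<^sup>p = (q * ramp' t)\<^sup>p * w\<^sup>p \<bar>u\<bar>\<^sup>p\<close>, so the upper bound is immediate, and
  the lower bound follows from the tangent inequality for the \<open>p\<close>-th power at \<open>\<gamma>\<close> and
  the fundamental theorem of calculus for \<open>\<tau> powr (1 - \<beta> * p) * \<bar>u\<bar> powr p\<close>. The test functions are
  \<open>u * cutoff (j - ramp t)\<close> with \<open>cutoff y = exp (- 1 / y)\<close>, whose derivative is bounded, so their
  gradients converge by dominated convergence.
\<close>

section \<open>Finite differentiability on open sets of reals\<close>

text \<open>The recursion of \<open>Ck\<close> in one real variable, but relative to a set, because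
  the profile below is given by different formulas on overlapping open sets.\<close>

primrec differentiable_upto :: "nat \<Rightarrow> real set \<Rightarrow> (real \<Rightarrow> real) \<Rightarrow> bool" where
  "differentiable_upto 0 S f \<longleftrightarrow> continuous_on S f"
| "differentiable_upto (Suc m) S f \<longleftrightarrow>
     (\<forall>x\<in>S. (f has_real_derivative deriv f x) (at x)) \<and> differentiable_upto m S (deriv f)"

lemma differentiable_upto_cong:
  assumes "open S" "\<And>x. x \<in> S \<Longrightarrow> f x = g x" "differentiable_upto m S f"
  shows "differentiable_upto m S g"
  using assms(2,3)
proof (induction m arbitrary: f g)
  case 0
  then show ?case by (simp cong: continuous_on_cong)
next
  case (Suc m)
  have d: "(g has_real_derivative deriv f x) (at x)" if "x \<in> S" for x
    using has_field_derivative_transform_within_open[OF _ assms(1) that, of f _ g] Suc.prems that by auto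
  have e: "deriv f x = deriv g x" if "x \<in> S" for x
    using DERIV_imp_deriv[OF d[OF that]] by simp
  show ?case using Suc.IH[of "deriv f" "deriv g"] Suc.prems d e by auto
qed

lemma differentiable_upto_SucI:
  assumes "open S" "\<And>x. x \<in> S \<Longrightarrow> (f has_real_derivative f' x) (at x)" "differentiable_upto m S f'"
  shows "differentiable_upto (Suc m) S f"
proof -
  have "deriv f x = f' x" if "x \<in> S" for x
    using assms(2)[OF that] by (rule DERIV_imp_deriv)
  then show ?thesis
    using assms differentiable_upto_cong[OF assms(1) _ assms(3), of "deriv f"] by auto
qed

lemma differentiable_upto_Suc_imp:
  "open S \<Longrightarrow> differentiable_upto (Suc m) S f \<Longrightarrow> differentiable_upto m S f"
proof (induction m arbitrary: f)
  case 0
  then show ?case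
    by (auto intro!: continuous_at_imp_continuous_on DERIV_isCont)
next
  case (Suc m)
  then show ?case by simp
qed

lemma differentiable_upto_const: "open S \<Longrightarrow> differentiable_upto m S (\<lambda>_. c)"
proof (induction m arbitrary: c)
  case (Suc m)
  then show ?case
    by (intro differentiable_upto_SucI[where f' = "\<lambda>_. 0"]) auto
qed auto

lemma differentiable_upto_id: "open S \<Longrightarrow> differentiable_upto m S (\<lambda>x. x)"
proof (cases m)
  case (Suc k)
  then show "open S \<Longrightarrow> differentiable_upto m S (\<lambda>x. x)"
    using differentiable_upto_SucI[of S "\<lambda>x. x" "\<lambda>_. 1" k] differentiable_upto_const by auto
qed auto

lemma differentiable_upto_add:
  assumes "open S"
  shows "differentiable_upto m S f \<Longrightarrow> differentiable_upto m S g \<Longrightarrow> differentiable_upto m S (\<lambda>x. f x + g x)"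
proof (induction m arbitrary: f g)
  case 0
  then show ?case by (simp add: continuous_on_add)
next
  case (Suc m)
  then show ?case
    by (intro differentiable_upto_SucI[OF assms, where f' = "\<lambda>x. deriv f x + deriv g x"])
       (simp_all add: DERIV_add)
qed

lemma differentiable_upto_mult:
  assumes "open S"
  shows "differentiable_upto m S f \<Longrightarrow> differentiable_upto m S g \<Longrightarrow> differentiable_upto m S (\<lambda>x. f x * g x)"
proof (induction m arbitrary: f g)
  case 0
  then show ?case by (simp add: continuous_on_mult)
next
  case (Suc m)
  show ?case
  proof (rule differentiable_upto_SucI[OF assms, where f' = "\<lambda>x. deriv f x * g x + deriv g x * f x"])
    show "differentiable_upto m S (\<lambda>x. deriv f x * g x + deriv g x * f x)"
      using Suc.prems Suc.prems[THEN differentiable_upto_Suc_imp[OF assms]]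
      by (intro differentiable_upto_add[OF assms] Suc.IH) simp_all
  qed (use Suc.prems in \<open>simp add: DERIV_mult\<close>)
qed

lemma differentiable_upto_compose:
  assumes "open S" "g ` S \<subseteq> T"
  shows "differentiable_upto m T f \<Longrightarrow> differentiable_upto m S g \<Longrightarrow> differentiable_upto m S (\<lambda>x. f (g x))"
  using assms(2)
proof (induction m arbitrary: f)
  case 0
  then show ?case by (simp add: continuous_on_compose2)
next
  case (Suc m)
  show ?case
  proof (rule differentiable_upto_SucI[OF assms(1), where f' = "\<lambda>x. deriv f (g x) * deriv g x"])
    show "differentiable_upto m S (\<lambda>x. deriv f (g x) * deriv g x)"
    proof (rule differentiable_upto_mult[OF assms(1)])
      show "differentiable_upto m S (\<lambda>x. deriv f (g x))"
        using Suc.prems(1) differentiable_upto_Suc_imp[OF assms(1) Suc.prems(2)] assms(2)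
        by (intro Suc.IH[of "deriv f"]) simp_all
    qed (use Suc.prems(2) in simp)
  next
    fix x assume "x \<in> S"
    then show "((\<lambda>x. f (g x)) has_real_derivative deriv f (g x) * deriv g x) (at x)"
      using Suc.prems(1,2) assms(2) by (intro DERIV_chain2) (simp_all add: image_subset_iff)
  qed
qed

text \<open>Differentiability at a point is already local, so the induction reduces gluing to
  continuity, where the openness of both sets enters.\<close>

lemma differentiable_upto_Un:
  assumes "open S" "open T"
  shows "differentiable_upto m S f \<Longrightarrow> differentiable_upto m T f \<Longrightarrow> differentiable_upto m (S \<union> T) f"
  by (induction m arbitrary: f) (auto intro: continuous_on_open_Un assms)

lemma differentiable_upto_subset:
  "differentiable_upto m T f \<Longrightarrow> S \<subseteq> T \<Longrightarrow> differentiable_upto m S f"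
  by (induction m arbitrary: f) (auto intro: continuous_on_subset)

lemma differentiable_upto_exp: "differentiable_upto m UNIV (exp :: real \<Rightarrow> real)"
proof (induction m)
  case (Suc m)
  then show ?case by (intro differentiable_upto_SucI[where f' = exp]) auto
qed (simp add: continuous_on_exp)

lemma differentiable_upto_powr: "differentiable_upto m {0<..} (\<lambda>x. x powr a)"
proof (induction m arbitrary: a)
  case 0
  then show ?case by (auto intro!: continuous_intros)
next
  case (Suc m)
  show ?case
    by (intro differentiable_upto_SucI[where f' = "\<lambda>x. a * x powr (a - 1)"] differentiable_upto_mult
        differentiable_upto_const Suc.IH) (auto intro!: derivative_eq_intros)
qed

lemma differentiable_upto_ln: "differentiable_upto m {0<..} (ln :: real \<Rightarrow> real)"
proof (cases m)
  case (Suc k)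
  show ?thesis unfolding Suc
    by (intro differentiable_upto_SucI[where f' = "\<lambda>x. x powr (-1)"] differentiable_upto_powr)
       (auto intro!: derivative_eq_intros simp: powr_minus_divide)
qed (auto intro!: continuous_intros)

section \<open>Functions flat at the origin\<close>

text \<open>The functions P(1/t) exp(-1/t), extended by 0, form a class closed under
  differentiation, so one induction makes every member smooth, also at 0.\<close>

definition flat_poly :: "real poly \<Rightarrow> real \<Rightarrow> real" where
  "flat_poly P t = (if t > 0 then poly P (1 / t) * exp (- (1 / t)) else 0)"

lemma tendsto_poly_times_exp_minus: "((\<lambda>y. poly P y * exp (- y)) \<longlongrightarrow> (0::real)) at_top"
proof -
  have "((\<lambda>y. \<Sum>i\<le>degree P. coeff P i * (y ^ i / exp y)) \<longlongrightarrow> (\<Sum>i\<le>degree P. coeff P i * 0)) at_top"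
    by (intro tendsto_intros tendsto_power_div_exp_0)
  then show ?thesis
    by (simp add: poly_altdef sum_distrib_right exp_minus divide_inverse mult.assoc)
qed

text \<open>With y = 1/t one has d/dt = -y^2 d/dy, and the derivative of P(y) exp(-y) is (P' - P)(y)
  exp(-y); hence the polynomial y^2 (P - P').\<close>

lemma flat_poly_has_derivative:
  "(flat_poly P has_real_derivative flat_poly (monom 1 2 * (P - pderiv P)) t) (at t)"
proof -
  let ?Q = "monom 1 2 * (P - pderiv P)"
  consider "t < 0" | "t = 0" | "t > 0" by linarith
  then show ?thesis
  proof cases
    case 1
    have "((\<lambda>_. 0) has_real_derivative flat_poly ?Q t) (at t)"
      using 1 by (simp add: flat_poly_def)
    then show ?thesis
      by (rule has_field_derivative_transform_within_open[where S = "{..<0}"])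
         (use 1 in \<open>auto simp: flat_poly_def\<close>)
  next
    case 2
    \<comment> \<open>Dividing by h multiplies the polynomial by one power of 1/h, so the difference
      quotient at 0 is again a \<open>flat_poly\<close>. From the right the exponential decay wins,
      on the left it is 0.\<close>
    have lim: "((\<lambda>h. flat_poly (monom 1 1 * P) h) \<longlongrightarrow> 0) (at 0)"
    proof -
      have r: "((\<lambda>h. flat_poly (monom 1 1 * P) h) \<longlongrightarrow> 0) (at_right 0)"
      proof (rule Lim_transform_eventually)
        show "((\<lambda>h. poly (monom 1 1 * P) (inverse h) * exp (- inverse h)) \<longlongrightarrow> 0) (at_right 0)"
          by (rule filterlim_compose[OF tendsto_poly_times_exp_minus filterlim_inverse_at_top_right])
        show "\<forall>\<^sub>F h in at_right 0. poly (monom 1 1 * P) (inverse h) * exp (- inverse h)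
                = flat_poly (monom 1 1 * P) h"
          using eventually_at_right_less[of 0]
          by eventually_elim (auto simp: flat_poly_def inverse_eq_divide)
      qed
      have l: "((\<lambda>h. flat_poly (monom 1 1 * P) h) \<longlongrightarrow> 0) (at_left 0)"
        by (rule Lim_transform_eventually[of "\<lambda>_. 0"])
           (auto simp: flat_poly_def eventually_at_filter)
      show ?thesis using l r by (simp add: filterlim_split_at)
    qed
    have "((\<lambda>h. (flat_poly P (0 + h) - flat_poly P 0) / h) \<longlongrightarrow> 0) (at 0)"
      using lim by (rule Lim_transform_eventually)
        (auto simp: flat_poly_def poly_monom eventually_at_filter field_simps)
    then show ?thesis
      using 2 by (simp add: DERIV_def flat_poly_def)
  next
    case 3
    have "((\<lambda>t. poly P (1 / t) * exp (- (1 / t))) has_real_derivative flat_poly ?Q t) (at t)"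
      using 3
      by (auto intro!: derivative_eq_intros DERIV_chain2[OF poly_DERIV]
           simp: flat_poly_def poly_monom field_simps power2_eq_square)
    then show ?thesis
      by (rule has_field_derivative_transform_within_open[where S = "{0<..}"])
         (use 3 in \<open>auto simp: flat_poly_def\<close>)
  qed
qed

lemma differentiable_upto_flat_poly: "differentiable_upto m UNIV (flat_poly P)"
proof (induction m arbitrary: P)
  case 0
  show ?case
    by (auto intro!: continuous_at_imp_continuous_on DERIV_isCont flat_poly_has_derivative)
next
  case (Suc m)
  then show ?case
    by (intro differentiable_upto_SucI[OF _ flat_poly_has_derivative]) auto
qed

section \<open>Smooth radial functions\<close>

lemma Ck_SucI:
  assumes "\<And>x. (f has_derivative f' x) (at x)" "\<And>h. Ck m (\<lambda>x. f' x h)"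
  shows "Ck (Suc m) f"
proof -
  have "frechet_derivative f (at x) = f' x" for x
    using assms(1) by (metis frechet_derivative_at)
  moreover have "f differentiable_on UNIV"
    using assms(1) by (auto simp: differentiable_on_def differentiable_def)
  ultimately show ?thesis using assms(2) by simp
qed

lemma Ck_Suc_has_derivative:
  "Ck (Suc m) f \<Longrightarrow> (f has_derivative frechet_derivative f (at x)) (at x)"
  by (simp add: differentiable_on_def frechet_derivative_works)

lemma Ck_Suc_imp: "Ck (Suc m) f \<Longrightarrow> Ck m f"
proof (induction m arbitrary: f)
  case 0
  then show ?case
    by (auto intro: differentiable_imp_continuous_on)
next
  case (Suc m)
  then show ?case by simp
qed

lemma Ck_const: "Ck m (\<lambda>_. c)"
proof (induction m arbitrary: c)
  case (Suc m)
  then show ?case by (intro Ck_SucI[where f' = "\<lambda>_ _. 0"]) auto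
qed simp

lemma Ck_bounded_linear: "bounded_linear f \<Longrightarrow> Ck m f"
proof (cases m)
  case (Suc k)
  then show "bounded_linear f \<Longrightarrow> Ck m f"
    using Ck_SucI[where f' = "\<lambda>_. f" and f = f and m = k] Ck_const
    by (auto intro: bounded_linear_imp_has_derivative)
qed (auto simp: linear_continuous_on)

lemma Ck_add: "Ck m f \<Longrightarrow> Ck m g \<Longrightarrow> Ck m (\<lambda>x. f x + g x)"
proof (induction m arbitrary: f g)
  case 0
  then show ?case by (simp add: continuous_on_add)
next
  case (Suc m)
  show ?case
  proof (rule Ck_SucI)
    show "((\<lambda>x. f x + g x) has_derivative
        (\<lambda>h. frechet_derivative f (at x) h + frechet_derivative g (at x) h)) (at x)" for x
      by (intro has_derivative_add Ck_Suc_has_derivative[OF Suc.prems(1)] Ck_Suc_has_derivative[OF Suc.prems(2)])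
  qed (use Suc in auto)
qed

lemma Ck_mult: "Ck m f \<Longrightarrow> Ck m g \<Longrightarrow> Ck m (\<lambda>x. f x * g x)"
proof (induction m arbitrary: f g)
  case 0
  then show ?case by (simp add: continuous_on_mult)
next
  case (Suc m)
  show ?case
  proof (rule Ck_SucI)
    show "((\<lambda>x. f x * g x) has_derivative
        (\<lambda>h. f x * frechet_derivative g (at x) h + frechet_derivative f (at x) h * g x)) (at x)" for x
      by (intro has_derivative_mult Ck_Suc_has_derivative[OF Suc.prems(1)] Ck_Suc_has_derivative[OF Suc.prems(2)])
    show "Ck m (\<lambda>x. f x * frechet_derivative g (at x) h + frechet_derivative f (at x) h * g x)" for h
      using Suc Ck_Suc_imp by (intro Ck_add Suc.IH) auto
  qed
qed

lemma has_derivative_radial: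
  fixes x :: "'a::real_inner"
  assumes "(H has_real_derivative d) (at (x \<bullet> x))"
  shows "((\<lambda>x. H (x \<bullet> x)) has_derivative (\<lambda>h. d * (2 * (x \<bullet> h)))) (at x)"
proof -
  have "((\<lambda>x. x \<bullet> x) has_derivative (\<lambda>h. 2 * (x \<bullet> h))) (at x)"
    by (auto intro!: derivative_eq_intros simp: inner_commute)
  from has_derivative_compose[OF this, of H "(*) d"] assms
  show ?thesis by (simp add: has_field_derivative_def)
qed

text \<open>The squared norm is used because it is smooth at the origin. Each directional derivative
  is a radial function of the same kind times a linear function, so the induction closes.\<close>

lemma Ck_radial:
  "(\<And>m. differentiable_upto m UNIV H) \<Longrightarrow> Ck m (\<lambda>x::real^'n. H (x \<bullet> x))"
proof (induction m arbitrary: H)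
  case 0
  have "continuous_on UNIV H" using "0"[of 0] by simp
  then show ?case by (auto intro!: continuous_intros continuous_on_compose2[of UNIV H])
next
  case (Suc m)
  show ?case
  proof (rule Ck_SucI)
    show "((\<lambda>x::real^'n. H (x \<bullet> x)) has_derivative (\<lambda>h. deriv H (x \<bullet> x) * (2 * (x \<bullet> h)))) (at x)" for x
      using Suc.prems[of "Suc 0"] by (intro has_derivative_radial) auto
    have "differentiable_upto k UNIV (deriv H)" for k using Suc.prems[of "Suc k"] by simp
    then show "Ck m (\<lambda>x::real^'n. deriv H (x \<bullet> x) * (2 * (x \<bullet> h)))" for h
      by (intro Ck_mult Suc.IH Ck_const Ck_bounded_linear bounded_linear_inner_left)
  qed
qed

lemma grad_radial:
  assumes "(H has_real_derivative d) (at (x \<bullet> x))"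
  shows "grad (\<lambda>x. H (x \<bullet> x)) x = (2 * d) *\<^sub>R x"
  using frechet_derivative_at[OF has_derivative_radial[OF assms], symmetric]
  by (simp add: grad_def vec_eq_iff inner_axis)

section \<open>Integration of derivatives and polar coordinates\<close>

text \<open>An exhaustion by closed intervals allows the fundamental theorem of calculus to be used
  away from the end points, where the weights may be singular. The limit of \<open>u\<close> serves
  to evaluate boundary values at \<open>b\<close>.\<close>

lemma inner_approximation_open_interval:
  fixes a b :: real
  assumes "a < b"
  obtains l u :: "nat \<Rightarrow> real" where
    "\<And>i. a < l i" "\<And>i. l i \<le> u i" "\<And>i. u i < b"
    "incseq (\<lambda>i. {l i..u i})" "(\<Union>i. {l i..u i}) = {a<..<b}" "u \<longlonglongrightarrow> b"
proof -
  \<comment> \<open>The shift by 2 gives \<open>d i \<le> (b - a) / 2\<close>, so that the left end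
    point never passes the right one.\<close>
  define d where "d i = (b - a) / (real i + 2)" for i :: nat
  have d0: "0 < d i" "d i \<le> (b - a) / 2" for i
    using assms by (auto simp: d_def field_simps intro: mult_right_mono)
  have dmono: "d j \<le> d i" if "i \<le> j" for i j
    using assms that by (auto simp: d_def intro!: divide_left_mono)
  have dlim: "d \<longlonglongrightarrow> 0"
    unfolding d_def by real_asymp
  have "a < a + d i" "a + d i \<le> b - d i" "b - d i < b" for i
    using d0[of i] by (simp_all add: field_simps)
  moreover have "incseq (\<lambda>i. {a + d i..b - d i})"
    by (auto simp: incseq_def dest!: dmono)
  moreover have "(\<Union>i. {a + d i..b - d i}) = {a<..<b}"
  proof (intro equalityI subsetI)
    fix x assume "x \<in> {a<..<b}"
    then have "0 < min (x - a) (b - x)" by auto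
    then have "\<forall>\<^sub>F i in sequentially. d i < min (x - a) (b - x)"
      using order_tendstoD(2)[OF dlim] by blast
    then obtain i where "d i < min (x - a) (b - x)"
      by (auto simp: eventually_sequentially)
    then show "x \<in> (\<Union>i. {a + d i..b - d i})" by (auto intro!: exI[of _ i])
  next
    fix x assume "x \<in> (\<Union>i. {a + d i..b - d i})"
    then obtain i where "a + d i \<le> x" "x \<le> b - d i" by auto
    then show "x \<in> {a<..<b}" using d0(1)[of i] by auto
  qed
  moreover have "(\<lambda>i. b - d i) \<longlonglongrightarrow> b"
    using tendsto_diff[OF tendsto_const dlim, of b] by simp
  ultimately show ?thesis by (rule that)
qed

text \<open>On each exhausting interval the integral is a difference of two values in [0, B];
  monotone convergence passes to the open interval without limits of \<open>F\<close> at its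
  ends.\<close>

lemma nn_integral_bounded_primitive:
  fixes a b :: real
  assumes "a < b" and meas: "(\<lambda>x. f x * indicator {a<..<b} x) \<in> borel_measurable borel"
    and F: "\<And>x. a < x \<Longrightarrow> x < b \<Longrightarrow> (F has_real_derivative f x) (at x)"
    and f0: "\<And>x. a < x \<Longrightarrow> x < b \<Longrightarrow> 0 \<le> f x"
    and FB: "\<And>x. a < x \<Longrightarrow> x < b \<Longrightarrow> 0 \<le> F x \<and> F x \<le> B"
  shows "(\<integral>\<^sup>+x. ennreal (f x) * indicator {a<..<b} x \<partial>lborel) \<le> ennreal B"
proof -
  obtain l u where lu: "\<And>i. a < l i" "\<And>i. l i \<le> u i" "\<And>i. u i < b"
    "incseq (\<lambda>i. {l i..u i})" "(\<Union>i. {l i..u i}) = {a<..<b}" "u \<longlonglongrightarrow> b"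
    by (rule inner_approximation_open_interval[OF assms(1)]) blast
  let ?g = "\<lambda>x. f x * indicator {a<..<b} x"
  have sub: "{l i..u i} \<subseteq> {a<..<b}" for i using lu(1,3)[of i] by auto
  have le: "(\<integral>\<^sup>+x. ennreal (?g x) * indicator {l i..u i} x \<partial>lborel) \<le> ennreal B" for i
  proof -
    have "(\<integral>\<^sup>+x. ennreal (?g x) * indicator {l i..u i} x \<partial>lborel) = ennreal (F (u i) - F (l i))"
      using sub[of i] meas lu(2) F f0
      by (intro nn_integral_FTC_Icc) (auto simp: indicator_def subset_iff)
    also have "\<dots> \<le> ennreal B"
      using FB[of "u i"] FB[of "l i"] lu(1-3)[of i] by (intro ennreal_leI) auto
    finally show ?thesis .
  qed
  have "(\<integral>\<^sup>+x. ennreal (f x) * indicator {a<..<b} x \<partial>lborel)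
      = (\<integral>\<^sup>+x. (SUP i. ennreal (?g x) * indicator {l i..u i} x) \<partial>lborel)"
  proof (intro nn_integral_cong)
    fix x
    show "ennreal (f x) * indicator {a<..<b} x = (SUP i. ennreal (?g x) * indicator {l i..u i} x)"
    proof (cases "x \<in> {a<..<b}")
      case True
      then obtain j where "x \<in> {l j..u j}" using lu(5) by blast
      then show ?thesis using True
        by (intro antisym SUP_upper2[of j] SUP_least) (auto simp: indicator_def)
    next
      case False
      then show ?thesis by (simp)
    qed
  qed
  also have "\<dots> = (SUP i. \<integral>\<^sup>+x. ennreal (?g x) * indicator {l i..u i} x \<partial>lborel)"
    using lu(4) meas
    by (intro nn_integral_monotone_convergence_SUP)
       (auto simp: incseq_def le_fun_def indicator_def subset_iff)
  also have "\<dots> \<le> ennreal B" by (intro SUP_least le)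
  finally show ?thesis .
qed

text \<open>Each partial integral is F(u) - F(l) \<le> F(u), which tends to 0. At the left end only
  the sign of \<open>F\<close> is used, whence an inequality.\<close>

lemma set_integral_derivative_nonpos:
  fixes a b :: real
  assumes "a < b" and int: "set_integrable lborel {a<..<b} f"
    and F: "\<And>x. a < x \<Longrightarrow> x < b \<Longrightarrow> (F has_real_derivative f x) (at x)"
    and F0: "\<And>x. a < x \<Longrightarrow> x < b \<Longrightarrow> 0 \<le> F x"
    and Fb: "(F \<longlongrightarrow> 0) (at_left b)"
  shows "set_lebesgue_integral lborel {a<..<b} f \<le> 0"
proof -
  obtain l u where lu: "\<And>i. a < l i" "\<And>i. l i \<le> u i" "\<And>i. u i < b"
    "incseq (\<lambda>i. {l i..u i})" "(\<Union>i. {l i..u i}) = {a<..<b}" "u \<longlonglongrightarrow> b"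
    by (rule inner_approximation_open_interval[OF assms(1)]) blast
  have "(\<lambda>i. set_lebesgue_integral lborel {l i..u i} f) \<longlonglongrightarrow> set_lebesgue_integral lborel (\<Union>i. {l i..u i}) f"
    using lu(4,5) int by (intro set_integral_cont_up) auto
  moreover have "set_lebesgue_integral lborel {l i..u i} f \<le> F (u i)" for i
  proof -
    have "set_integrable lborel {l i..u i} f"
      by (intro set_integrable_subset[OF int]) (use lu(1,3)[of i] in auto)
    then have "set_lebesgue_integral lborel {l i..u i} f = integral {l i..u i} f"
      by (rule set_borel_integral_eq_integral)
    also have "\<dots> = F (u i) - F (l i)"
    proof (intro integral_unique fundamental_theorem_of_calculus lu(2))
      fix x assume "x \<in> {l i..u i}"
      then show "(F has_vector_derivative f x) (at x within {l i..u i})"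
        using F[of x] lu(1,3)[of i]
        by (auto simp: has_real_derivative_iff_has_vector_derivative intro: has_vector_derivative_at_within)
    qed
    also have "\<dots> \<le> F (u i)" using F0[of "l i"] lu(1-3)[of i] by auto
    finally show ?thesis .
  qed
  moreover have "(\<lambda>i. F (u i)) \<longlonglongrightarrow> 0"
    using lu(3,6) by (intro filterlim_compose[OF Fb]) (auto simp: filterlim_at intro!: eventually_sequentiallyI)
  ultimately show ?thesis
    unfolding lu(5) by (intro LIMSEQ_le[of _ _ "\<lambda>i. F (u i)" 0]) auto
qed

text \<open>Polar coordinates for radial functions. Finite measures on the line are compared on the
  rays above x: on one side this is the volume of a shell, on the other the integral of the
  derivative of \<open>unit_ball_vol n * r ^ n\<close>.\<close>

lemma distr_norm_lborel:
  fixes R :: real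
  defines "n \<equiv> DIM('a::euclidean_space)"
  assumes R: "0 < R"
  shows "distr (density lborel (indicator (ball (0::'a) R))) borel norm
    = density lborel (\<lambda>r. ennreal (real n * unit_ball_vol n * r ^ (n - 1)) * indicator {0<..<R} r)"
    (is "?M = ?N")
proof (rule measure_eqI_lessThan)
  have [measurable]: "(indicator (ball (0::'a) R) :: 'a \<Rightarrow> ennreal) \<in> borel_measurable borel"
    by (intro borel_measurable_indicator) simp
  have n: "n > 0" by (simp add: n_def)
  have M: "emeasure ?M {x<..} = emeasure lborel (ball 0 R - cball (0::'a) x)" for x
  proof -
    have [measurable]: "norm -` {x<..} \<in> sets (borel :: 'a measure)"
      by (intro borel_open open_vimage) (auto intro!: continuous_intros)
    have "emeasure ?M {x<..} = (\<integral>\<^sup>+y. indicator (ball (0::'a) R \<inter> norm -` {x<..}) y \<partial>lborel)"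
      by (simp add: emeasure_distr, subst emeasure_density) (simp_all add: indicator_inter_arith[symmetric])
    also have "\<dots> = emeasure lborel (ball (0::'a) R \<inter> norm -` {x<..})"
      by (intro nn_integral_indicator) simp
    also have "ball (0::'a) R \<inter> norm -` {x<..} = ball 0 R - cball 0 x"
      by auto
    finally show ?thesis .
  qed
  have eq: "emeasure ?N {x<..} = ennreal (unit_ball_vol n * (R ^ n - x ^ n))"
    if x: "0 \<le> x" "x \<le> R" for x
  proof -
    have "emeasure ?N {x<..} = (\<integral>\<^sup>+r. ennreal (real n * unit_ball_vol n * r ^ (n - 1)) * indicator {0<..<R} r * indicator {x<..} r \<partial>lborel)"
      by (subst emeasure_density) auto
    \<comment> \<open>The intervals differ only in their end points, which are null sets.\<close>
    also have "\<dots> = (\<integral>\<^sup>+r. ennreal (real n * unit_ball_vol n * r ^ (n - 1)) * indicator {x..R} r \<partial>lborel)"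
      using AE_lborel_singleton[of x] AE_lborel_singleton[of R] x
      by (intro nn_integral_cong_AE) (auto simp: indicator_def elim!: eventually_elim2)
    also have "\<dots> = ennreal (unit_ball_vol n * R ^ n - unit_ball_vol n * x ^ n)"
    proof (rule nn_integral_FTC_Icc)
      fix y assume "y \<in> {x..R}"
      then show "0 \<le> real n * unit_ball_vol n * y ^ (n - 1)"
        using x by (intro mult_nonneg_nonneg unit_ball_vol_nonneg) auto
      have "((\<lambda>y. unit_ball_vol n * y ^ n) has_real_derivative
          unit_ball_vol n * (real n * y ^ (n - 1))) (at y)"
        using DERIV_cmult[OF DERIV_pow[of n y UNIV], of "unit_ball_vol n"] by simp
      then show "((\<lambda>y. unit_ball_vol n * y ^ n) has_real_derivative
          real n * unit_ball_vol n * y ^ (n - 1)) (at y)"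
        by (simp add: mult.assoc mult.left_commute)
    qed (use x in auto)
    finally show ?thesis by (simp add: algebra_simps)
  qed
  have Meq: "emeasure ?M {x<..} = ennreal (unit_ball_vol n * (R ^ n - x ^ n))"
    if x: "0 \<le> x" "x \<le> R" for x
  \<comment> \<open>For x = R the closed ball is not contained in the open one, so the volumes can
    be subtracted only for x < R.\<close>
  proof (cases "x = R")
    case True
    then have "ball 0 R - cball (0::'a) x = {}" by auto
    then have "emeasure ?M {x<..} = emeasure lborel ({} :: 'a set)" by (simp only: M)
    then show ?thesis using True by simp
  next
    case False
    then show ?thesis using x R
      by (subst M, subst emeasure_Diff)
         (auto simp: emeasure_ball emeasure_cball n_def ennreal_minus algebra_simps)
  qed
  have neg: "emeasure ?M {x<..} = emeasure ?M {0<..} \<and> emeasure ?N {x<..} = emeasure ?N {0<..}" if "x < 0" for x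
  proof
    have "emeasure ?M {x<..} = emeasure lborel (ball 0 R :: 'a set)"
      using that by (simp add: M)
    also have "\<dots> = emeasure ?M {0<..}"
      using R by (subst Meq) (auto simp: emeasure_ball n_def)
    finally show "emeasure ?M {x<..} = emeasure ?M {0<..}" .
    show "emeasure ?N {x<..} = emeasure ?N {0<..}"
      using that by (subst (1 2) emeasure_density) (auto intro!: nn_integral_cong simp: indicator_def)
  qed
  have big: "emeasure ?M {x<..} = 0 \<and> emeasure ?N {x<..} = 0" if "R < x" for x
  proof
    have "ball 0 R - cball (0::'a) x = {}" using that by auto
    then have "emeasure ?M {x<..} = emeasure lborel ({} :: 'a set)" by (simp only: M)
    then show "emeasure ?M {x<..} = 0" by simp
    show "emeasure ?N {x<..} = 0"
      using that by (subst emeasure_density) (auto simp: nn_integral_0_iff_AE indicator_def)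
  qed
  show e: "emeasure ?M {x<..} = emeasure ?N {x<..}" for x
  proof -
    consider "x < 0" | "0 \<le> x" "x \<le> R" | "R < x" by linarith
    then show ?thesis
      by cases (use neg big eq Meq R in auto)
  qed
  show "emeasure ?M {x<..} < \<infinity>" for x
  proof -
    have "emeasure ?M {x<..} \<le> emeasure lborel (ball 0 R :: 'a set)"
      unfolding M by (intro emeasure_mono) auto
    also have "\<dots> < \<infinity>" using R by (simp add: emeasure_ball)
    finally show ?thesis .
  qed
qed simp_all

lemma nn_integral_radial:
  fixes R :: real
  defines "n \<equiv> DIM('a::euclidean_space)"
  assumes R: "0 < R" and f: "f \<in> borel_measurable borel"
  shows "(\<integral>\<^sup>+x. f (norm x) * indicator (ball (0::'a) R) x \<partial>lborel)
    = (\<integral>\<^sup>+r. f r * ennreal (real n * unit_ball_vol n * r ^ (n - 1)) * indicator {0<..<R} r \<partial>lborel)"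
proof -
  note f[measurable]
  have [measurable]: "(indicator (ball (0::'a) R) :: 'a \<Rightarrow> ennreal) \<in> borel_measurable borel"
    by (intro borel_measurable_indicator) simp
  have "(\<integral>\<^sup>+x. f (norm x) * indicator (ball (0::'a) R) x \<partial>lborel)
      = (\<integral>\<^sup>+r. f r \<partial>distr (density lborel (indicator (ball (0::'a) R))) borel norm)"
    by (simp add: nn_integral_distr, subst nn_integral_density) (auto simp: mult.commute)
  also have "\<dots> = (\<integral>\<^sup>+r. f r * ennreal (real n * unit_ball_vol n * r ^ (n - 1)) * indicator {0<..<R} r \<partial>lborel)"
    unfolding distr_norm_lborel[OF R] n_def
    by (subst nn_integral_density) (auto intro!: nn_integral_cong simp: ac_simps)
  finally show ?thesis .
qed

section \<open>The ramp and the cutoff\<close>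

abbreviation "cutoff \<equiv> flat_poly 1"
abbreviation "cutoff' \<equiv> flat_poly (monom 1 2)"

definition ramp :: "real \<Rightarrow> real" where "ramp t = t * cutoff t"

text \<open>\<open>ramp\<close> grows like t and is not a \<open>flat_poly\<close>, but its
  derivative (1 + 1/t) exp(-1/t) is one.\<close>

abbreviation "ramp' \<equiv> flat_poly [:1, 1:]"

lemma flat_poly_nonpos [simp]: "t \<le> 0 \<Longrightarrow> flat_poly P t = 0"
  by (simp add: flat_poly_def)

lemma flat_poly_measurable [measurable]: "flat_poly P \<in> borel_measurable borel"
  using differentiable_upto_flat_poly[of 0 P] by (simp add: borel_measurable_continuous_onI)

lemma cutoff_bounds: "0 \<le> cutoff t" "cutoff t \<le> 1"
  by (auto simp: flat_poly_def)

lemma cutoff_has_derivative: "(cutoff has_real_derivative cutoff' t) (at t)"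
  using flat_poly_has_derivative[of 1 t] by simp

text \<open>With y = 1/t this is y^2 exp(-y) \<le> 2, from the quadratic Taylor bound for exp. The
  constant 2 returns in the majorant factor \<open>q + 2\<close>.\<close>

lemma cutoff'_bounds: "0 \<le> cutoff' t" "cutoff' t \<le> 2"
proof -
  show "0 \<le> cutoff' t" by (simp add: flat_poly_def poly_monom)
  have "y\<^sup>2 * exp (- y) \<le> 2" if "y > 0" for y :: real
  proof -
    have "1 + y + y\<^sup>2 / 2 \<le> exp y" using exp_lower_Taylor_quadratic[of y] that by simp
    then have "y\<^sup>2 \<le> 2 * exp y" using that by linarith
    then show ?thesis by (simp add: exp_minus divide_simps)
  qed
  from this[of "1 / t"] show "cutoff' t \<le> 2" by (auto simp: flat_poly_def poly_monom)
qed

lemma ramp_has_derivative: "(ramp has_real_derivative ramp' t) (at t)"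
proof -
  have "((\<lambda>t. t * cutoff t) has_real_derivative cutoff' t * t + cutoff t) (at t)"
    by (auto intro!: derivative_eq_intros cutoff_has_derivative)
  moreover have "cutoff' t * t + cutoff t = ramp' t"
    by (auto simp: flat_poly_def poly_monom power2_eq_square field_simps)
  ultimately show ?thesis by (simp add: ramp_def[abs_def])
qed

lemma ramp'_bounds: "0 \<le> ramp' t" "ramp' t \<le> 1"
proof -
  show "0 \<le> ramp' t" by (simp add: flat_poly_def)
  have "(1 + y) * exp (- y) \<le> 1" for y :: real
    using exp_ge_add_one_self[of y] by (simp add: exp_minus divide_simps)
  from this[of "1 / t"] show "ramp' t \<le> 1" by (auto simp: flat_poly_def)
qed

lemma ramp_nonpos [simp]: "t \<le> 0 \<Longrightarrow> ramp t = 0"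
  by (simp add: ramp_def)

lemma ramp_ge: "t - 1 \<le> ramp t"
proof (cases "t > 0")
  case True
  have "1 - 1 / t \<le> exp (- (1 / t))" using exp_ge_add_one_self[of "- (1 / t)"] by simp
  then have "t * (1 - 1 / t) \<le> t * exp (- (1 / t))" using True by (intro mult_left_mono) auto
  then show ?thesis using True by (simp add: ramp_def flat_poly_def algebra_simps)
qed simp

lemma ramp_measurable [measurable]: "ramp \<in> borel_measurable borel"
  unfolding ramp_def[abs_def] by measurable

lemma differentiable_upto_ramp: "differentiable_upto m UNIV ramp"
  unfolding ramp_def[abs_def]
  by (intro differentiable_upto_mult differentiable_upto_id differentiable_upto_flat_poly) auto

lemma cutoff_tendsto_1: "(\<lambda>j. cutoff (real j - z)) \<longlonglongrightarrow> 1"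
proof (rule Lim_transform_eventually)
  show "(\<lambda>j. exp (- (1 / (real j - z)))) \<longlonglongrightarrow> 1" by real_asymp
  have "\<forall>\<^sub>F j in sequentially. z < real j"
    using filterlim_real_sequentially by (auto simp: filterlim_at_top_dense)
  then show "\<forall>\<^sub>F j in sequentially. exp (- (1 / (real j - z))) = cutoff (real j - z)"
    by eventually_elim (simp add: flat_poly_def)
qed

lemma cutoff'_tendsto_0: "(\<lambda>j. cutoff' (real j - z)) \<longlonglongrightarrow> 0"
proof (rule Lim_transform_eventually)
  show "(\<lambda>j. (1 / (real j - z))\<^sup>2 * exp (- (1 / (real j - z)))) \<longlonglongrightarrow> 0" by real_asymp
  have "\<forall>\<^sub>F j in sequentially. z < real j"
    using filterlim_real_sequentially by (auto simp: filterlim_at_top_dense)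
  then show "\<forall>\<^sub>F j in sequentially. (1 / (real j - z))\<^sup>2 * exp (- (1 / (real j - z))) = cutoff' (real j - z)"
    by eventually_elim (simp add: flat_poly_def poly_monom)
qed

section \<open>Weighted energies\<close>

lemma nn_integral_eq_set_integral:
  assumes "set_integrable M A f" "\<And>x. x \<in> A \<Longrightarrow> 0 \<le> f x"
  shows "(\<integral>\<^sup>+x. ennreal (f x) * indicator A x \<partial>M) = ennreal (set_lebesgue_integral M A f)"
proof -
  have "(\<integral>\<^sup>+x. ennreal (f x) * indicator A x \<partial>M) = (\<integral>\<^sup>+x. ennreal (indicator A x *\<^sub>R f x) \<partial>M)"
    by (intro nn_integral_cong) (simp add: indicator_def)
  also have "\<dots> = ennreal (set_lebesgue_integral M A f)"
    using assms unfolding set_integrable_def set_lebesgue_integral_def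
    by (intro nn_integral_eq_integral) (auto simp: indicator_def)
  finally show ?thesis .
qed

text \<open>Weight and field may change together, and so may the type of the values; this turns the
  \<open>v\<close>-energy of a vector field into the \<open>w\<close>-energy of a scalar
  function.\<close>

lemma weighted_energy_cong:
  assumes "\<And>x. x \<in> \<Omega> \<Longrightarrow> v x powr p * norm (F x) powr p = w x powr p * norm (F' x) powr p"
  shows "weighted_energy p \<Omega> v F = weighted_energy p \<Omega> w F'"
  unfolding weighted_energy_def
  by (intro nn_integral_cong) (simp add: assms)

lemma weighted_energy_radial:
  fixes \<omega> h :: "real \<Rightarrow> real" and lam :: real
  defines "N \<equiv> CARD('n::finite)"
  assumes [measurable]: "\<omega> \<in> borel_measurable borel" "h \<in> borel_measurable borel" and "0 < lam"
  shows "weighted_energy p {x::real^'n. norm x < lam} (\<lambda>x. \<omega> (norm x)) (\<lambda>x. h (norm x))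
    = (\<integral>\<^sup>+r. ennreal (real N * unit_ball_vol N * r ^ (N - 1) * (\<omega> r powr p * \<bar>h r\<bar> powr p))
        * indicator {0<..<lam} r \<partial>lborel)"
proof -
  have ball: "{x::real^'n. norm x < lam} = ball 0 lam" by auto
  have "weighted_energy p {x::real^'n. norm x < lam} (\<lambda>x. \<omega> (norm x)) (\<lambda>x. h (norm x))
      = (\<integral>\<^sup>+x. ennreal (\<omega> (norm x) powr p * \<bar>h (norm x)\<bar> powr p) * indicator (ball (0::real^'n) lam) x \<partial>lborel)"
    unfolding ball weighted_energy_def
    by (subst nn_integral_restrict_space) (auto simp: nn_integral_completion)
  also have "\<dots> = (\<integral>\<^sup>+r. ennreal (\<omega> r powr p * \<bar>h r\<bar> powr p) *
      ennreal (real N * unit_ball_vol N * r ^ (N - 1)) * indicator {0<..<lam} r \<partial>lborel)"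
    by (subst nn_integral_radial[OF \<open>0 < lam\<close>, where f = "\<lambda>r. ennreal (\<omega> r powr p * \<bar>h r\<bar> powr p)"])
       (simp_all add: N_def)
  also have "\<dots> = (\<integral>\<^sup>+r. ennreal (real N * unit_ball_vol N * r ^ (N - 1) * (\<omega> r powr p * \<bar>h r\<bar> powr p))
        * indicator {0<..<lam} r \<partial>lborel)"
    by (intro nn_integral_cong) (auto simp: ennreal_mult'[symmetric] mult.commute indicator_def)
  finally show ?thesis .
qed

section \<open>The one-dimensional variable\<close>

text \<open>Convexity on the open half line. At x = 0 the claim is checked directly: it reads (1 -
  p) \<gamma>^p \<le> 0.\<close>

lemma powr_ge_tangent:
  fixes x \<gamma> p :: real
  assumes "0 \<le> x" "0 < \<gamma>" "1 < p"
  shows "\<gamma> powr p + p * \<gamma> powr (p - 1) * (x - \<gamma>) \<le> x powr p"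
proof (cases "x = 0")
  case True
  have "\<gamma> powr p = \<gamma> powr (p - 1) * \<gamma>" using assms by (simp add: powr_diff)
  moreover have "0 \<le> (p - 1) * \<gamma> powr p" using assms by simp
  ultimately show ?thesis using True assms by (simp add: algebra_simps)
next
  case False
  have "p * \<gamma> powr (p - 1) * (x - \<gamma>) \<le> x powr p - \<gamma> powr p"
  proof (rule convex_on_imp_above_tangent)
    show "convex_on {0<..} (\<lambda>x. x powr p)" using assms by (intro powr_convex) auto
    show "((\<lambda>x. x powr p) has_real_derivative p * \<gamma> powr (p - 1)) (at \<gamma> within {0<..})"
      using assms by (auto intro!: derivative_eq_intros)
  qed (use assms False in \<open>auto simp: interior_open\<close>)
  then show ?thesis by simp
qed

lemma g_fun_pos: "0 < s \<Longrightarrow> s < 1 \<Longrightarrow> 0 < g_fun k s"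
  using powr01_less_one[of s k] powr01_less_one[of s "- k"]
  by (cases k "0::real" rule: linorder_cases)
     (auto simp: g_fun_def divide_simps powr_minus ln_div)

lemma g_fun_measurable [measurable]: "g_fun k \<in> borel_measurable borel"
  unfolding g_fun_def[abs_def] by measurable

text \<open>The dimension is a plain number here and is identified with \<open>CARD('n)\<close> only
  where energies over \<open>real^'n\<close> are computed.\<close>

locale hardy_weights =
  fixes n :: nat and \<alpha> \<beta> p lam \<epsilon> :: real
  assumes n: "0 < n" and lam: "0 < lam" and p: "1 < p" and bp: "1 < \<beta> * p" and eps: "0 < \<epsilon>"
begin

definition "k = k_par n \<alpha> \<beta> p"
definition "a = \<beta> * p - 1"
definition "\<gamma> = a / p"
definition "q = \<gamma> * (1 + \<epsilon>)"

definition g :: "real \<Rightarrow> real" where "g r = g_fun k (r / lam)"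

text \<open>The factor s^(-k) makes d(ln \<tau>) = -dr / (r g). Since k a = n - \<alpha> p, the
  power \<tau>^(-a) also carries exactly the power of r found in the radial measure.\<close>

definition \<tau> :: "real \<Rightarrow> real" where "\<tau> r = (r / lam) powr (- k) * g r"
text \<open>Normalised to vanish at half the radius, so that \<open>ramp (T r)\<close> is 0, and the
  profile constant, on the inner half of the ball.\<close>

definition T :: "real \<Rightarrow> real" where "T r = ln (\<tau> (lam / 2)) - ln (\<tau> r)"

lemma a_pos: "0 < a" and gamma_pos: "0 < \<gamma>" and q_pos: "0 < q" and p_gamma: "p * \<gamma> = a"
  using p bp eps by (auto simp: a_def \<gamma>_def q_def)

lemma qp_gt: "a < q * p"
proof -
  have "q * p = a * (1 + \<epsilon>)" using p by (simp add: q_def \<gamma>_def)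
  then show ?thesis using a_pos eps by simp
qed

lemma g_pos: "0 < r \<Longrightarrow> r < lam \<Longrightarrow> 0 < g r"
  unfolding g_def using lam by (intro g_fun_pos) auto

lemma tau_pos: "0 < r \<Longrightarrow> r < lam \<Longrightarrow> 0 < \<tau> r"
  unfolding \<tau>_def using g_pos lam by simp

text \<open>This form holds for all positive r, also at the boundary r = \<open>lam\<close>, where
  it gives the value 0; together with the derivative below it yields the boundary limit of
  \<open>T\<close>.\<close>

lemma tau_eq:
  assumes "0 < r"
  shows "\<tau> r = (if k = 0 then ln lam - ln r else ((r / lam) powr (- k) - 1) / k)"
  using assms lam by (auto simp: \<tau>_def g_def g_fun_def ln_div powr_minus field_simps)

lemma tau_has_derivative:
  assumes "0 < r"
  shows "(\<tau> has_real_derivative - ((r / lam) powr (- k) / r)) (at r)"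
proof -
  have "((\<lambda>r. if k = 0 then ln lam - ln r else ((r / lam) powr (- k) - 1) / k)
      has_real_derivative - ((r / lam) powr (- k) / r)) (at r)"
    using assms lam
    by (cases "k = 0") (auto intro!: derivative_eq_intros simp: powr_diff field_simps powr_minus)
  then show ?thesis
    by (rule has_field_derivative_transform_within_open[where S = "{0<..}"])
       (use assms tau_eq in auto)
qed

lemma T_has_derivative:
  assumes "0 < r" "r < lam"
  shows "(T has_real_derivative 1 / (r * g r)) (at r)"
proof -
  have "(T has_real_derivative 0 - 1 / \<tau> r * - ((r / lam) powr (- k) / r)) (at r)"
    unfolding T_def[abs_def] using assms tau_pos[OF assms]
    by (intro DERIV_diff DERIV_const DERIV_chain2[OF DERIV_ln_divide] tau_has_derivative)
  moreover have "0 - 1 / \<tau> r * - ((r / lam) powr (- k) / r) = 1 / (r * g r)"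
    using assms lam g_pos[OF assms] by (simp add: \<tau>_def)
  ultimately show ?thesis by (simp only:)
qed

lemma T_mono:
  assumes "0 < r" "r \<le> r'" "r' < lam"
  shows "T r \<le> T r'"
proof (rule DERIV_nonneg_imp_nondecreasing[OF assms(2)])
  fix x assume "r \<le> x" "x \<le> r'"
  then show "\<exists>y. (T has_real_derivative y) (at x) \<and> 0 \<le> y"
    using T_has_derivative[of x] g_pos[of x] assms by (intro exI[of _ "1 / (x * g x)"]) auto
qed

lemma T_half: "T (lam / 2) = 0"
  by (simp add: T_def)

lemma T_nonpos: "0 < r \<Longrightarrow> r \<le> lam / 2 \<Longrightarrow> T r \<le> 0"
  using T_mono[of r "lam / 2"] T_half lam by simp

lemma T_at_top: "filterlim T at_top (at_left lam)"
proof -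
  have "\<tau> lam = 0" using lam tau_eq[of lam] by simp
  then have "(\<tau> \<longlongrightarrow> 0) (at_left lam)"
    using DERIV_isCont[OF tau_has_derivative[OF lam]]
    by (metis continuous_within filterlim_at_split isCont_def)
  moreover have "\<forall>\<^sub>F r in at_left lam. 0 < \<tau> r"
    using eventually_at_left_real[OF lam] by eventually_elim (auto intro: tau_pos)
  ultimately have "filterlim \<tau> (at_right 0) (at_left lam)"
    by (auto simp: filterlim_at elim: eventually_mono)
  then have "filterlim (\<lambda>r. - ln (\<tau> r)) at_top (at_left lam)"
    by (intro filterlim_compose[OF filterlim_uminus_at_top_at_bot] filterlim_compose[OF ln_at_0])
  then show ?thesis
    unfolding T_def[abs_def] diff_conv_add_uminus
    by (rule filterlim_tendsto_add_at_top[OF tendsto_const])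
qed

lemma g_measurable [measurable]: "g \<in> borel_measurable borel"
  unfolding g_def[abs_def] by measurable

lemma T_measurable [measurable]: "T \<in> borel_measurable borel"
  unfolding T_def[abs_def] \<tau>_def[abs_def] by measurable

text \<open>In the variable \<rho> = r^2 the derivative of \<tau> is a constant times a power of
  \<rho>, so smoothness follows from that of powers and of the logarithm.\<close>

lemma differentiable_upto_T_sqrt: "differentiable_upto m {0<..<lam\<^sup>2} (\<lambda>\<rho>. T (sqrt \<rho>))"
proof -
  have sq: "0 < sqrt \<rho>" "sqrt \<rho> < lam" if "\<rho> \<in> {0<..<lam\<^sup>2}" for \<rho>
    using that lam by (auto intro: real_less_lsqrt)
  have "differentiable_upto (Suc m) {0<..<lam\<^sup>2} (\<lambda>\<rho>. \<tau> (sqrt \<rho>))"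
  proof (rule differentiable_upto_SucI)
    fix \<rho> assume \<rho>: "\<rho> \<in> {0<..<lam\<^sup>2}"
    have "((\<lambda>\<rho>. \<tau> (sqrt \<rho>)) has_real_derivative
        - ((sqrt \<rho> / lam) powr (- k) / sqrt \<rho>) * (inverse (sqrt \<rho>) / 2)) (at \<rho>)"
      using \<rho> sq[OF \<rho>] by (intro DERIV_chain2[OF tau_has_derivative] DERIV_real_sqrt) auto
    moreover have "- ((sqrt \<rho> / lam) powr (- k) / sqrt \<rho>) * (inverse (sqrt \<rho>) / 2)
        = (- (lam powr k / 2)) * \<rho> powr (- k / 2 - 1)"
    proof -
      have "(sqrt \<rho> / lam) powr (- k) = \<rho> powr (- k / 2) * lam powr k"
        using \<rho> lam by (simp add: powr_divide powr_half_sqrt[symmetric] powr_powr powr_minus field_simps)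
      moreover have "\<rho> powr (- k / 2 - 1) = \<rho> powr (- k / 2) / (sqrt \<rho> * sqrt \<rho>)"
        using \<rho> by (simp add: powr_diff)
      ultimately show ?thesis by (simp add: field_simps)
    qed
    ultimately show "((\<lambda>\<rho>. \<tau> (sqrt \<rho>)) has_real_derivative
        (- (lam powr k / 2)) * \<rho> powr (- k / 2 - 1)) (at \<rho>)" by (simp only:)
  next
    show "differentiable_upto m {0<..<lam\<^sup>2} (\<lambda>\<rho>. (- (lam powr k / 2)) * \<rho> powr (- k / 2 - 1))"
      by (intro differentiable_upto_mult differentiable_upto_const
          differentiable_upto_subset[OF differentiable_upto_powr]) auto
  qed simp
  then have "differentiable_upto m {0<..<lam\<^sup>2} (\<lambda>\<rho>. \<tau> (sqrt \<rho>))"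
    by (rule differentiable_upto_Suc_imp[rotated]) simp
  then have "differentiable_upto m {0<..<lam\<^sup>2} (\<lambda>\<rho>. ln (\<tau> (sqrt \<rho>)))"
    using sq tau_pos by (intro differentiable_upto_compose[OF _ _ differentiable_upto_ln]) auto
  then have "differentiable_upto m {0<..<lam\<^sup>2} (\<lambda>\<rho>. ln (\<tau> (lam / 2)) + (- 1) * ln (\<tau> (sqrt \<rho>)))"
    by (intro differentiable_upto_add differentiable_upto_mult differentiable_upto_const) auto
  then show ?thesis by (simp add: T_def)
qed

section \<open>The profile in the variable of the squared norm, and its truncations\<close>

text \<open>\<open>ramp\<close> of \<open>T\<close> as a function of the squared norm. The threshold
  is the square of \<open>lam / 2\<close>, where \<open>T\<close> is 0; the explicit zero branch
  fixes the value at and below \<rho> = 0, where \<open>T (sqrt \<rho>)\<close> has no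
  meaning.\<close>

definition Z :: "real \<Rightarrow> real" where
  "Z \<rho> = (if \<rho> \<le> lam\<^sup>2 / 4 then 0 else ramp (T (sqrt \<rho>)))"

definition Z' :: "real \<Rightarrow> real" where
  "Z' \<rho> = (if \<rho> \<le> lam\<^sup>2 / 4 then 0 else ramp' (T (sqrt \<rho>)) / (2 * \<rho> * g (sqrt \<rho>)))"

lemma T_sqrt_nonpos:
  assumes "0 < \<rho>" "\<rho> \<le> lam\<^sup>2 / 4"
  shows "T (sqrt \<rho>) \<le> 0"
proof (rule T_nonpos)
  show "sqrt \<rho> \<le> lam / 2"
    using assms lam by (intro real_le_lsqrt) (simp_all add: power_divide)
qed (use assms in simp)

lemma Z_eq: "0 < \<rho> \<Longrightarrow> Z \<rho> = ramp (T (sqrt \<rho>))"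
  and Z'_eq: "0 < \<rho> \<Longrightarrow> Z' \<rho> = ramp' (T (sqrt \<rho>)) / (2 * \<rho> * g (sqrt \<rho>))"
  using T_sqrt_nonpos by (auto simp: Z_def Z'_def)

text \<open>The zero branch covers a neighbourhood of the origin and the composed formula all
  positive \<rho>; they agree on the overlap because \<open>T\<close> is nonpositive there.\<close>

lemma differentiable_upto_Z: "differentiable_upto m {..<lam\<^sup>2} Z"
proof -
  have "0 < lam\<^sup>2" using lam by simp
  then have "\<rho> < lam\<^sup>2" if "\<rho> < lam\<^sup>2 / 4" for \<rho> using that by linarith
  moreover have "0 < \<rho> \<or> \<rho> < lam\<^sup>2 / 4" for \<rho> using \<open>0 < lam\<^sup>2\<close> by linarith
  ultimately have "{..<lam\<^sup>2} = {..<lam\<^sup>2 / 4} \<union> {0<..<lam\<^sup>2}" by auto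
  moreover have "differentiable_upto m ({..<lam\<^sup>2 / 4} \<union> {0<..<lam\<^sup>2}) Z"
  proof (rule differentiable_upto_Un)
    show "differentiable_upto m {..<lam\<^sup>2 / 4} Z"
      by (rule differentiable_upto_cong[OF _ _ differentiable_upto_const[of _ _ 0]]) (auto simp: Z_def)
    have "differentiable_upto m {0<..<lam\<^sup>2} (\<lambda>\<rho>. ramp (T (sqrt \<rho>)))"
      by (intro differentiable_upto_compose[OF _ _ differentiable_upto_ramp]
          differentiable_upto_T_sqrt) auto
    then show "differentiable_upto m {0<..<lam\<^sup>2} Z"
      by (rule differentiable_upto_cong[rotated 2]) (auto simp: Z_eq)
  qed auto
  ultimately show ?thesis by simp
qed

lemma Z_has_derivative:
  assumes "\<rho> < lam\<^sup>2"
  shows "(Z has_real_derivative Z' \<rho>) (at \<rho>)"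
proof (cases "\<rho> > 0")
  case True
  have sq: "0 < sqrt \<rho>" "sqrt \<rho> < lam" using True assms lam by (auto intro: real_less_lsqrt)
  have "((\<lambda>\<rho>. ramp (T (sqrt \<rho>))) has_real_derivative
      ramp' (T (sqrt \<rho>)) * (1 / (sqrt \<rho> * g (sqrt \<rho>)) * (inverse (sqrt \<rho>) / 2))) (at \<rho>)"
    using True sq by (intro DERIV_chain2[OF ramp_has_derivative] DERIV_chain2[OF T_has_derivative] DERIV_real_sqrt) auto
  moreover have "ramp' (T (sqrt \<rho>)) * (1 / (sqrt \<rho> * g (sqrt \<rho>)) * (inverse (sqrt \<rho>) / 2)) = Z' \<rho>"
    using True by (simp add: Z'_eq field_simps)
  ultimately have "((\<lambda>\<rho>. ramp (T (sqrt \<rho>))) has_real_derivative Z' \<rho>) (at \<rho>)" by simp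
  then show ?thesis
    by (rule has_field_derivative_transform_within_open[where S = "{0<..}"]) (use True in \<open>auto simp: Z_eq\<close>)
next
  case False
  then have \<rho>: "\<rho> < lam\<^sup>2 / 4" using lam by (smt (verit) zero_less_divide_iff zero_less_power)
  then have "((\<lambda>_. 0) has_real_derivative Z' \<rho>) (at \<rho>)" by (simp add: Z'_def)
  then show ?thesis
    by (rule has_field_derivative_transform_within_open[where S = "{..<lam\<^sup>2 / 4}"])
       (use \<rho> in \<open>auto simp: Z_def\<close>)
qed

definition Q :: "nat \<Rightarrow> real \<Rightarrow> real" where
  "Q j z = exp (- q * z) * cutoff (real j - z)"

definition Q' :: "nat \<Rightarrow> real \<Rightarrow> real" where
  "Q' j z = - exp (- q * z) * (q * cutoff (real j - z) + cutoff' (real j - z))"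

lemma Q_has_derivative: "(Q j has_real_derivative Q' j z) (at z)"
  unfolding Q_def[abs_def] Q'_def
  by (auto intro!: derivative_eq_intros DERIV_chain2[OF cutoff_has_derivative] simp: algebra_simps)

lemma differentiable_upto_Q: "differentiable_upto m UNIV (Q j)"
proof -
  have "differentiable_upto m UNIV (\<lambda>z. exp (- q * z) * cutoff (real j + (- 1) * z))"
    by (intro differentiable_upto_mult differentiable_upto_compose[OF _ _ differentiable_upto_exp]
        differentiable_upto_compose[OF _ _ differentiable_upto_flat_poly]
        differentiable_upto_add differentiable_upto_const differentiable_upto_id) auto
  then show ?thesis by (simp add: Q_def[abs_def])
qed

text \<open>Extended by 0 outside the ball, which is smooth because the truncation already vanishes
  near the boundary.\<close>

definition H :: "nat \<Rightarrow> real \<Rightarrow> real" where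
  "H j \<rho> = (if \<rho> < lam\<^sup>2 then Q j (Z \<rho>) else 0)"

lemma H_has_derivative:
  assumes "\<rho> < lam\<^sup>2"
  shows "(H j has_real_derivative Q' j (Z \<rho>) * Z' \<rho>) (at \<rho>)"
  using DERIV_chain2[OF Q_has_derivative Z_has_derivative[OF assms]]
  by (rule has_field_derivative_transform_within_open[where S = "{..<lam\<^sup>2}"])
     (use assms in \<open>auto simp: H_def\<close>)

lemma H_eventually_zero:
  obtains R where "0 \<le> R" "R < lam" "\<And>\<rho>. R\<^sup>2 < \<rho> \<Longrightarrow> H j \<rho> = 0"
proof -
  \<comment> \<open>The extra 1 compensates the lag of \<open>ramp\<close> behind its argument,
    which is at most 1.\<close>
  have "\<forall>\<^sub>F r in at_left lam. real j + 1 \<le> T r"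
    using T_at_top by (auto simp: filterlim_at_top)
  then obtain R0 where R0: "R0 < lam" "\<And>r. R0 < r \<Longrightarrow> r < lam \<Longrightarrow> real j + 1 \<le> T r"
    using eventually_at_left[OF lam] by auto
  \<comment> \<open>The maximum with 0 ensures that R^2 < \<rho> gives both \<rho> > 0 and R0 <
    \<open>sqrt \<rho>\<close>.\<close>
  define R where "R = max 0 R0"
  have "H j \<rho> = 0" if \<rho>: "R\<^sup>2 < \<rho>" for \<rho>
  proof (cases "\<rho> < lam\<^sup>2")
    case True
    have "0 < \<rho>" using \<rho> by (smt (verit) zero_le_power2)
    have "R < sqrt \<rho>" using \<rho> by (rule real_less_rsqrt)
    moreover have "sqrt \<rho> < lam" using True lam \<open>0 < \<rho>\<close> by (auto intro: real_less_lsqrt)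
    ultimately have "real j + 1 \<le> T (sqrt \<rho>)" by (intro R0) (auto simp: R_def)
    then have "real j \<le> Z \<rho>" using ramp_ge[of "T (sqrt \<rho>)"] \<open>0 < \<rho>\<close> by (simp add: Z_eq)
    then show ?thesis by (simp add: H_def Q_def)
  qed (simp add: H_def)
  then show ?thesis using that[of R] R0 lam by (auto simp: R_def)
qed

lemma differentiable_upto_H: "differentiable_upto m UNIV (H j)"
proof -
  obtain R where R: "0 \<le> R" "R < lam" "\<And>\<rho>. R\<^sup>2 < \<rho> \<Longrightarrow> H j \<rho> = 0"
    by (rule H_eventually_zero[of j]) blast
  have "R\<^sup>2 < lam\<^sup>2" using R by (intro power_strict_mono) auto
  then have "UNIV = {..<lam\<^sup>2} \<union> {R\<^sup>2<..}" by auto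
  moreover have "differentiable_upto m ({..<lam\<^sup>2} \<union> {R\<^sup>2<..}) (H j)"
  proof (rule differentiable_upto_Un)
    have "differentiable_upto m {..<lam\<^sup>2} (\<lambda>\<rho>. Q j (Z \<rho>))"
      by (intro differentiable_upto_compose[OF _ _ differentiable_upto_Q] differentiable_upto_Z) auto
    then show "differentiable_upto m {..<lam\<^sup>2} (H j)"
      by (rule differentiable_upto_cong[rotated 2]) (auto simp: H_def)
    show "differentiable_upto m {R\<^sup>2<..} (H j)"
      by (rule differentiable_upto_cong[OF _ _ differentiable_upto_const[of _ _ 0]]) (auto simp: R)
  qed auto
  ultimately show ?thesis by simp
qed

lemma H_in_Cc_infinity: "(\<lambda>x::real^'n. H j (x \<bullet> x)) \<in> Cc_infinity {x. norm x < lam}"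
proof -
  obtain R where R: "0 \<le> R" "R < lam" "\<And>\<rho>. R\<^sup>2 < \<rho> \<Longrightarrow> H j \<rho> = 0"
    by (rule H_eventually_zero[of j]) blast
  have "norm x \<le> R" if "H j (x \<bullet> x) \<noteq> 0" for x :: "real^'n"
    using R that by (metis dot_square_norm not_less power2_le_imp_le)
  then have sub: "closure {x::real^'n. H j (x \<bullet> x) \<noteq> 0} \<subseteq> cball 0 R"
    by (intro closure_minimal) auto
  then have "compact (closure {x::real^'n. H j (x \<bullet> x) \<noteq> 0})"
    using bounded_subset[OF bounded_cball sub] by (simp add: compact_eq_bounded_closed)
  moreover have "Ck m (\<lambda>x::real^'n. H j (x \<bullet> x))" for m
    by (intro Ck_radial differentiable_upto_H)
  moreover have "cball (0::real^'n) R \<subseteq> {x. norm x < lam}" using R(2) by auto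
  ultimately show ?thesis using sub unfolding Cc_infinity_def by blast
qed

section \<open>The energy density and its integrability\<close>

text \<open>Up to a constant factor this is \<tau>^(1 - \<beta> p) |u|^p, since
  \<open>exp (a * T r)\<close> is a constant multiple of \<tau>^(-a).\<close>

definition E :: "real \<Rightarrow> real" where
  "E r = exp (a * T r - q * p * ramp (T r))"

text \<open>\<open>E\<close> times the derivative of \<open>T\<close>; up to the factor
  \<open>K\<close> below, the radial density of w^p |u|^p.\<close>

definition e :: "real \<Rightarrow> real" where
  "e r = E r / (r * g r)"

lemma E_measurable [measurable]: "E \<in> borel_measurable borel"
  and e_measurable [measurable]: "e \<in> borel_measurable borel"
  unfolding E_def[abs_def] e_def[abs_def] by measurable

lemma e_pos: "0 < r \<Longrightarrow> r < lam \<Longrightarrow> 0 < e r"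
  using g_pos by (simp add: e_def E_def)

text \<open>Replacing \<open>ramp\<close> by its lower bound T - 1 costs the factor
  \<open>exp (q * p)\<close>.\<close>

lemma E_le: "E r \<le> exp (q * p) * exp (- (q * p - a) * T r)"
proof -
  have "q * p * (T r - 1) \<le> q * p * ramp (T r)"
    using q_pos p ramp_ge by (intro mult_left_mono) auto
  then have "a * T r - q * p * ramp (T r) \<le> q * p + - (q * p - a) * T r"
    by (simp add: algebra_simps)
  then show ?thesis unfolding E_def exp_add[symmetric] by simp
qed

text \<open>The decay rate q p - a is positive because \<epsilon> > 0, and \<open>T\<close> tends to
  infinity at the boundary.\<close>

lemma E_tendsto: "(E \<longlongrightarrow> 0) (at_left lam)"
proof (rule tendsto_sandwich)
  show "((\<lambda>_. 0) \<longlongrightarrow> 0) (at_left lam)" by simp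
  have "filterlim (\<lambda>r. - (q * p - a) * T r) at_bot (at_left lam)"
    using qp_gt by (intro filterlim_tendsto_neg_mult_at_bot[OF tendsto_const _ T_at_top]) auto
  then have "((\<lambda>r. exp (- (q * p - a) * T r)) \<longlongrightarrow> 0) (at_left lam)"
    by (rule filterlim_compose[OF exp_at_bot])
  then show "((\<lambda>r. exp (q * p) * exp (- (q * p - a) * T r)) \<longlongrightarrow> 0) (at_left lam)"
    by (rule tendsto_mult_right_zero)
  show "\<forall>\<^sub>F r in at_left lam. 0 \<le> E r" by (simp add: E_def)
  show "\<forall>\<^sub>F r in at_left lam. E r \<le> exp (q * p) * exp (- (q * p - a) * T r)"
    using E_le by (rule always_eventually[OF allI])
qed

lemma E_has_derivative:
  assumes "0 < r" "r < lam"
  shows "(E has_real_derivative (a - q * p * ramp' (T r)) * e r) (at r)"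
proof -
  have "(E has_real_derivative exp (a * T r - q * p * ramp (T r)) *
      (a * (1 / (r * g r)) - q * p * (ramp' (T r) * (1 / (r * g r))))) (at r)"
    unfolding E_def[abs_def]
    by (intro DERIV_fun_exp DERIV_diff DERIV_cmult DERIV_chain2[OF ramp_has_derivative] T_has_derivative assms)
  moreover have "exp (a * T r - q * p * ramp (T r)) *
      (a * (1 / (r * g r)) - q * p * (ramp' (T r) * (1 / (r * g r)))) = (a - q * p * ramp' (T r)) * e r"
    by (simp add: e_def E_def algebra_simps diff_divide_distrib)
  ultimately show ?thesis by (simp only:)
qed

text \<open>
  \<open>E\<close> decays like \<open>exp (- \<kappa> * \<bar>T r\<bar>)\<close>, which is dominated by the derivative of \<open>arctan (exp (\<kappa> * T r))\<close>
  up to the factor \<open>T'\<close>.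
\<close>
lemma e_integrable: "set_integrable lborel {0<..<lam} e"
proof -
  \<comment> \<open>The smaller of the two decay rates: a for negative \<open>T\<close>, q p - a for
    positive \<open>T\<close>.\<close>
  define \<kappa> where "\<kappa> = min a (q * p - a)"
  have \<kappa>: "0 < \<kappa>" "\<kappa> \<le> a" "\<kappa> \<le> q * p - a" using a_pos qp_gt by (auto simp: \<kappa>_def)
  define B where "B r = 2 * exp (q * p) * (exp (\<kappa> * T r) / (1 + (exp (\<kappa> * T r))\<^sup>2)) / (r * g r)" for r
  define F where "F r = 2 * exp (q * p) / \<kappa> * arctan (exp (\<kappa> * T r))" for r
  \<comment> \<open>With y = exp(\<kappa> T), the function 2y / (1 + y^2) dominates y for y \<le> 1
    and 1/y for y \<ge> 1, so one majorant serves both signs of \<open>T\<close>.\<close>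
  have bound: "E r \<le> 2 * exp (q * p) * (exp (\<kappa> * T r) / (1 + (exp (\<kappa> * T r))\<^sup>2))" for r
  proof (cases "T r \<le> 0")
    case True
    have "E r \<le> exp (\<kappa> * T r)"
      using True \<kappa>(2) by (simp add: E_def mult_right_mono_neg)
    also have "\<dots> \<le> 2 * (exp (\<kappa> * T r) / (1 + (exp (\<kappa> * T r))\<^sup>2))"
    proof -
      have "(exp (\<kappa> * T r))\<^sup>2 \<le> 1\<^sup>2" using True \<kappa>(1) by (intro power_mono) (auto simp: mult_nonneg_nonpos)
      then show ?thesis by (simp add: field_simps add_pos_nonneg)
    qed
    also have "\<dots> \<le> exp (q * p) * (2 * (exp (\<kappa> * T r) / (1 + (exp (\<kappa> * T r))\<^sup>2)))"
    proof -
      have one: "1 \<le> exp (q * p)" using q_pos p by simp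
      have "0 \<le> 2 * (exp (\<kappa> * T r) / (1 + (exp (\<kappa> * T r))\<^sup>2))"
        by (intro mult_nonneg_nonneg divide_nonneg_nonneg add_nonneg_nonneg) auto
      from mult_right_mono[OF one this] show ?thesis by (simp only: mult_1)
    qed
    finally show ?thesis by (simp add: mult_ac)
  next
    case False
    have "E r \<le> exp (q * p) * exp (- (q * p - a) * T r)" by (rule E_le)
    also have "\<dots> \<le> exp (q * p) * exp (- \<kappa> * T r)"
    proof -
      have "- (q * p - a) * T r \<le> - \<kappa> * T r"
        using False \<kappa>(3) by (intro mult_right_mono) auto
      then show ?thesis by simp
    qed
    also have "exp (- \<kappa> * T r) \<le> 2 * (exp (\<kappa> * T r) / (1 + (exp (\<kappa> * T r))\<^sup>2))"
    proof -
      have "1\<^sup>2 \<le> (exp (\<kappa> * T r))\<^sup>2" using False \<kappa>(1) by (intro power_mono) auto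
      then show ?thesis by (simp add: exp_minus field_simps add_pos_nonneg power2_eq_square)
    qed
    finally show ?thesis by (simp add: mult_ac)
  qed
  have F: "(F has_real_derivative B r) (at r)" if "0 < r" "r < lam" for r
  proof -
    have "(F has_real_derivative 2 * exp (q * p) / \<kappa> *
        (inverse (1 + (exp (\<kappa> * T r))\<^sup>2) * (exp (\<kappa> * T r) * (\<kappa> * (1 / (r * g r)))))) (at r)"
      unfolding F_def[abs_def]
      by (intro DERIV_cmult DERIV_chain2[OF DERIV_arctan] DERIV_fun_exp T_has_derivative that)
    moreover have "2 * exp (q * p) / \<kappa> *
        (inverse (1 + (exp (\<kappa> * T r))\<^sup>2) * (exp (\<kappa> * T r) * (\<kappa> * (1 / (r * g r))))) = B r"
      using \<kappa>(1) by (simp add: B_def inverse_eq_divide)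
    ultimately show ?thesis by (simp only:)
  qed
  have "(\<integral>\<^sup>+r. ennreal (norm (indicator {0<..<lam} r *\<^sub>R e r)) \<partial>lborel)
      \<le> (\<integral>\<^sup>+r. ennreal (B r) * indicator {0<..<lam} r \<partial>lborel)"
  proof (intro nn_integral_mono)
    fix r
    have "e r \<le> B r" if "0 < r" "r < lam"
      unfolding e_def B_def using g_pos[OF that] that bound[of r]
      by (intro divide_right_mono) auto
    then show "ennreal (norm (indicator {0<..<lam} r *\<^sub>R e r)) \<le> ennreal (B r) * indicator {0<..<lam} r"
      using e_pos[of r] by (auto simp: indicator_def intro!: ennreal_leI)
  qed
  also have "\<dots> \<le> ennreal (2 * exp (q * p) / \<kappa> * (pi / 2))"
  proof (rule nn_integral_bounded_primitive[OF lam])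
    show "(\<lambda>x. B x * indicator {0<..<lam} x) \<in> borel_measurable borel"
      unfolding B_def[abs_def] by measurable
    fix r assume r: "0 < r" "r < lam"
    show "(F has_real_derivative B r) (at r)" by (rule F[OF r])
    show "0 \<le> B r" using r g_pos[OF r] by (auto simp: B_def intro!: divide_nonneg_nonneg add_nonneg_nonneg)
    have "0 \<le> arctan (exp (\<kappa> * T r))" "arctan (exp (\<kappa> * T r)) \<le> pi / 2"
      using arctan_ubound[of "exp (\<kappa> * T r)"] by auto
    then show "0 \<le> F r \<and> F r \<le> 2 * exp (q * p) / \<kappa> * (pi / 2)"
      unfolding F_def using \<kappa>(1) by (intro conjI mult_nonneg_nonneg mult_left_mono) auto
  qed
  also have "\<dots> < \<infinity>" by simp
  finally show ?thesis
    unfolding set_integrable_def by (intro integrableI_bounded) auto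
qed

lemma mult_e_integrable:
  assumes [measurable]: "h \<in> borel_measurable borel" and "\<And>r. \<bar>h r\<bar> \<le> M"
  shows "set_integrable lborel {0<..<lam} (\<lambda>r. h r * e r)"
proof (rule set_integrable_bound)
  show "set_integrable lborel {0<..<lam} (\<lambda>r. M * e r)"
    using e_integrable by (intro set_integrable_mult_right) auto
  show "set_borel_measurable lborel {0<..<lam} (\<lambda>r. h r * e r)"
    unfolding set_borel_measurable_def by measurable
  show "AE r in lborel. r \<in> {0<..<lam} \<longrightarrow> norm (h r * e r) \<le> norm (M * e r)"
    using assms(2) order_trans[OF abs_ge_zero assms(2)]
    by (intro AE_I2) (auto simp: abs_mult intro!: mult_right_mono)
qed

section \<open>The one-dimensional Hardy inequality for the profile\<close>

text \<open>\<open>RI\<close> and \<open>LI\<close> are the quantities R and L of the theorem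
  without their common factor \<open>K\<close>.\<close>

definition "RI = (LINT r:{0<..<lam}|lborel. e r)"
definition "LI = (LINT r:{0<..<lam}|lborel. (q * ramp' (T r)) powr p * e r)"

lemma powr_ramp'_bounds: "0 \<le> (q * ramp' (T r)) powr p" "(q * ramp' (T r)) powr p \<le> q powr p"
  using q_pos p ramp'_bounds[of "T r"] by (auto intro!: powr_mono2 mult_left_le)

lemma LI_integrable: "set_integrable lborel {0<..<lam} (\<lambda>r. (q * ramp' (T r)) powr p * e r)"
  using powr_ramp'_bounds by (intro mult_e_integrable[where M = "q powr p"]) auto

lemma RI_pos: "0 < RI"
proof -
  have nn: "0 \<le> indicator {0<..<lam} r *\<^sub>R e r" for r
    using e_pos[of r] by (auto simp: indicator_def)
  have int: "integrable lborel (\<lambda>r. indicator {0<..<lam} r *\<^sub>R e r)"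
    using e_integrable by (simp add: set_integrable_def)
  have "RI \<noteq> 0"
  proof
    assume "RI = 0"
    then have "AE r in lborel. indicator {0<..<lam} r *\<^sub>R e r = 0"
      unfolding RI_def set_lebesgue_integral_def
      using integral_nonneg_eq_0_iff_AE[OF int] nn by auto
    then have "AE r in lborel. r \<notin> {0<..<lam}"
      by (rule AE_mp) (use e_pos in \<open>force intro!: AE_I2 simp: indicator_def\<close>)
    then have "emeasure lborel {0<..<lam} = 0"
      by (subst (asm) AE_iff_measurable[of "{0<..<lam}"]) auto
    then show False using lam by simp
  qed
  moreover have "0 \<le> RI"
    unfolding RI_def set_lebesgue_integral_def using nn by (intro Bochner_Integration.integral_nonneg) auto
  ultimately show ?thesis by simp
qed

lemma LI_upper: "LI \<le> q powr p * RI"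
proof -
  have "LI \<le> (LINT r:{0<..<lam}|lborel. q powr p * e r)"
    unfolding LI_def
    by (intro set_integral_mono LI_integrable set_integrable_mult_right e_integrable mult_right_mono
        powr_ramp'_bounds) (auto intro: less_imp_le e_pos)
  then show ?thesis by (simp add: RI_def)
qed

text \<open>The tangent inequality at \<gamma>, taken at x = q ramp'(T) and integrated against
  \<open>e\<close>, bounds \<open>LI\<close> below by \<gamma>^p RI - \<gamma>^(p-1) J, where J is
  the integral of the derivative of \<open>E\<close>.\<close>

lemma LI_lower: "\<gamma> powr p * RI \<le> LI"
proof -
  define J where "J = (LINT r:{0<..<lam}|lborel. (a - q * p * ramp' (T r)) * e r)"
  have bnd: "\<bar>a - q * p * ramp' (T r)\<bar> \<le> a + q * p" for r
  proof -
    have "0 \<le> q * p * ramp' (T r)" "q * p * ramp' (T r) \<le> q * p"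
      using q_pos p ramp'_bounds[of "T r"] by (auto intro!: mult_left_le)
    then show ?thesis using a_pos by linarith
  qed
  have int: "set_integrable lborel {0<..<lam} (\<lambda>r. (a - q * p * ramp' (T r)) * e r)"
    using bnd by (intro mult_e_integrable) auto
  \<comment> \<open>\<open>E\<close> is nonnegative and vanishes in the limit at the
    boundary.\<close>
  have "J \<le> 0"
    unfolding J_def
    by (rule set_integral_derivative_nonpos[OF lam int E_has_derivative _ E_tendsto]) (auto simp: E_def)
  have "\<gamma> powr p * RI - \<gamma> powr (p - 1) * J
      = (LINT r:{0<..<lam}|lborel. \<gamma> powr p * e r - \<gamma> powr (p - 1) * ((a - q * p * ramp' (T r)) * e r))"
    unfolding RI_def J_def set_integral_mult_right[symmetric]
    by (intro set_integral_diff(2)[symmetric] set_integrable_mult_right int e_integrable)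
  also have "\<dots> \<le> LI"
    unfolding LI_def
  proof (intro set_integral_mono LI_integrable set_integral_diff(1) set_integrable_mult_right int e_integrable)
    fix r assume r: "r \<in> {0<..<lam}"
    \<comment> \<open>The relation p \<gamma> = a matches the tangent line with the factor a - q p
      ramp' in the derivative of \<open>E\<close>.\<close>
    have "\<gamma> powr p * e r - \<gamma> powr (p - 1) * ((a - q * p * ramp' (T r)) * e r)
        = (\<gamma> powr p + p * \<gamma> powr (p - 1) * (q * ramp' (T r) - \<gamma>)) * e r"
      using p_gamma[symmetric] by (simp add: algebra_simps)
    also have "\<dots> \<le> (q * ramp' (T r)) powr p * e r"
      using r e_pos[of r] q_pos gamma_pos p ramp'_bounds[of "T r"]
      by (intro mult_right_mono powr_ge_tangent) auto
    finally show "\<gamma> powr p * e r - \<gamma> powr (p - 1) * ((a - q * p * ramp' (T r)) * e r)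
        \<le> (q * ramp' (T r)) powr p * e r" .
  qed
  finally have "\<gamma> powr p * RI - \<gamma> powr (p - 1) * J \<le> LI" .
  moreover have "\<gamma> powr (p - 1) * J \<le> 0" using \<open>J \<le> 0\<close> by (simp add: mult_nonneg_nonpos)
  ultimately show ?thesis by linarith
qed

section \<open>Transfer between the ball and the radial interval\<close>

text \<open>The area of the unit sphere, the scaling left over from passing from r to r /
  \<open>lam\<close>, and the factor undoing the normalisation of \<open>T\<close>.\<close>

definition "K = real n * unit_ball_vol n * lam powr (real n - \<alpha> * p) * \<tau> (lam / 2) powr (- a)"

lemma K_pos: "0 < K"
  using n lam tau_pos[of "lam / 2"] by (simp add: K_def)

lemma radial_density:
  assumes "0 < r" "r < lam"
  shows "real n * unit_ball_vol n * r ^ (n - 1) * (r powr (- \<alpha>) * \<bar>g r\<bar> powr (- \<beta>)) powr p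
    = K * (exp (a * T r) / (r * g r))"
proof -
  have half: "0 < \<tau> (lam / 2)" using lam by (intro tau_pos) auto
  have "exp (a * T r) = \<tau> (lam / 2) powr a * \<tau> r powr (- a)"
    using half tau_pos[OF assms] by (simp add: T_def powr_def algebra_simps flip: exp_add)
  \<comment> \<open>Here k a = n - \<alpha> p is used: it is the reason for the exponent k in the
    weights.\<close>
  also have "\<tau> r powr (- a) = (r / lam) powr (real n - \<alpha> * p) * g r powr (- a)"
    using assms lam g_pos[OF assms] a_pos
    by (simp add: \<tau>_def powr_mult powr_powr k_def k_par_def a_def[symmetric])
  finally have "K * (exp (a * T r) / (r * g r))
      = real n * unit_ball_vol n * (lam powr (real n - \<alpha> * p) * (r / lam) powr (real n - \<alpha> * p))
        * (\<tau> (lam / 2) powr (- a) * \<tau> (lam / 2) powr a) * (g r powr (- a) / g r) / r"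
    by (simp add: K_def mult_ac)
  also have "lam powr (real n - \<alpha> * p) * (r / lam) powr (real n - \<alpha> * p) = r powr (real n - \<alpha> * p)"
    using assms lam by (simp flip: powr_mult)
  also have "\<tau> (lam / 2) powr (- a) * \<tau> (lam / 2) powr a = 1"
    using half by (simp flip: powr_add)
  also have "g r powr (- a) / g r = g r powr (- \<beta> * p)"
    using g_pos[OF assms] by (simp add: a_def powr_diff powr_minus field_simps)
  finally have "K * (exp (a * T r) / (r * g r))
      = real n * unit_ball_vol n * (r powr (real n - \<alpha> * p) / r) * g r powr (- \<beta> * p)" by simp
  moreover have "r powr (real n - \<alpha> * p) / r = r ^ (n - 1) * r powr (- \<alpha> * p)"
  proof -
    have "r ^ (n - 1) = r powr (real n - 1)" using n assms by (simp add: powr_realpow[symmetric] of_nat_diff)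
    then show ?thesis using assms by (simp add: powr_diff powr_minus field_simps)
  qed
  ultimately show ?thesis
    using assms g_pos[OF assms] by (simp add: powr_mult powr_powr)
qed

lemma w_energy_eq:
  assumes n_eq: "n = CARD('n::finite)" and [measurable]: "h \<in> borel_measurable borel"
  shows "weighted_energy p {x::real^'n. norm x < lam} (w_weight \<alpha> \<beta> p lam) (\<lambda>x. h (norm x))
    = (\<integral>\<^sup>+r. ennreal (K * (exp (a * T r) / (r * g r)) * \<bar>h r\<bar> powr p) * indicator {0<..<lam} r \<partial>lborel)"
proof -
  have "w_weight \<alpha> \<beta> p lam = (\<lambda>x::real^'n. norm x powr (- \<alpha>) * \<bar>g (norm x)\<bar> powr (- \<beta>))"
    by (simp add: fun_eq_iff w_weight_def g_def k_def n_eq[symmetric])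
  then have "weighted_energy p {x::real^'n. norm x < lam} (w_weight \<alpha> \<beta> p lam) (\<lambda>x. h (norm x))
    = (\<integral>\<^sup>+r. ennreal (real n * unit_ball_vol n * r ^ (n - 1) *
        ((r powr (- \<alpha>) * \<bar>g r\<bar> powr (- \<beta>)) powr p * \<bar>h r\<bar> powr p)) * indicator {0<..<lam} r \<partial>lborel)"
    using weighted_energy_radial[where 'n = 'n and \<omega> = "\<lambda>r. r powr (- \<alpha>) * \<bar>g r\<bar> powr (- \<beta>)" and h = h]
      lam by (simp add: n_eq[symmetric])
  also have "\<dots> = (\<integral>\<^sup>+r. ennreal (K * (exp (a * T r) / (r * g r)) * \<bar>h r\<bar> powr p)
        * indicator {0<..<lam} r \<partial>lborel)"
    using radial_density
    by (intro nn_integral_cong) (auto simp: indicator_def mult.assoc[symmetric])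
  finally show ?thesis .
qed

text \<open>Pointwise, the vector has norm |c| ramp'(T) / (r g), and v = r g w. The coefficient
  \<open>c\<close> is arbitrary, so that both \<open>grad_U\<close> and the approximation errors are
  covered.\<close>

lemma v_energy_radial_gradient:
  assumes n_eq: "n = CARD('n::finite)"
  shows "weighted_energy p {x::real^'n. norm x < lam} (v_weight \<alpha> \<beta> p lam)
      (\<lambda>x. (2 * (c (norm x) * Z' ((norm x)\<^sup>2))) *\<^sub>R x)
    = weighted_energy p {x::real^'n. norm x < lam} (w_weight \<alpha> \<beta> p lam)
      (\<lambda>x. c (norm x) * ramp' (T (norm x)))"
proof (rule weighted_energy_cong)
  fix x :: "real^'n" assume "x \<in> {x. norm x < lam}"
  then have x: "norm x < lam" by simp
  show "v_weight \<alpha> \<beta> p lam x powr p * norm ((2 * (c (norm x) * Z' ((norm x)\<^sup>2))) *\<^sub>R x) powr p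
      = w_weight \<alpha> \<beta> p lam x powr p * norm (c (norm x) * ramp' (T (norm x))) powr p"
  proof (cases "x = 0")
    \<comment> \<open>At the origin both sides are 0: on the left the vector vanishes, on the right
      \<open>0 powr (- \<alpha>)\<close> is 0.\<close>
    case True
    then show ?thesis by (simp add: w_weight_def)
  next
    case False
    define r where "r = norm x"
    have r: "0 < r" "r < lam" using False x by (auto simp: r_def)
    have g: "0 < g r" using g_pos r by simp
    have vw: "v_weight \<alpha> \<beta> p lam x = r powr (1 - \<alpha>) * g r powr (1 - \<beta>)"
      "w_weight \<alpha> \<beta> p lam x = r powr (- \<alpha>) * g r powr (- \<beta>)"
      using g by (auto simp: v_weight_def w_weight_def g_def k_def n_eq[symmetric] r_def)
    have "v_weight \<alpha> \<beta> p lam x * norm ((2 * (c r * Z' (r\<^sup>2))) *\<^sub>R x)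
        = (r powr (1 - \<alpha>) * g r powr (1 - \<beta>)) * (\<bar>c r\<bar> * ramp' (T r) / (r * g r))"
      using r g ramp'_bounds[of "T r"]
      by (simp add: vw Z'_eq abs_mult r_def[symmetric] power2_eq_square)
    also have "\<dots> = w_weight \<alpha> \<beta> p lam x * norm (c r * ramp' (T r))"
      using r g ramp'_bounds[of "T r"]
      by (simp add: vw abs_mult powr_diff powr_minus field_simps)
    finally have "(v_weight \<alpha> \<beta> p lam x * norm ((2 * (c r * Z' (r\<^sup>2))) *\<^sub>R x)) powr p
        = (w_weight \<alpha> \<beta> p lam x * norm (c r * ramp' (T r))) powr p" by simp
    then show ?thesis
      using vw by (simp add: powr_mult r_def[symmetric] del: norm_scaleR)
  qed
qed

lemma Z_measurable [measurable]: "Z \<in> borel_measurable borel"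
  and Z'_measurable [measurable]: "Z' \<in> borel_measurable borel"
  unfolding Z_def[abs_def] Z'_def[abs_def] by measurable

lemma Q'_measurable [measurable]: "Q' j \<in> borel_measurable borel"
  unfolding Q'_def[abs_def] by measurable

lemma Z_square: "0 < r \<Longrightarrow> Z (r\<^sup>2) = ramp (T r)"
  by (simp add: Z_eq)

lemma exp_minus_ramp_powr: "exp (a * T r) / (r * g r) * exp (- q * ramp (T r)) powr p = e r"
proof -
  have "exp (a * T r) * exp (- q * ramp (T r)) powr p = E r"
    by (simp add: E_def powr_def mult_ac flip: exp_add)
  then show ?thesis by (simp add: e_def)
qed

section \<open>The near-extremal function and its approximation by test functions\<close>

text \<open>Written with \<open>Z\<close> so that the value at the origin is 1, as on the whole
  inner half of the ball.\<close>

definition U :: "'a::real_normed_vector \<Rightarrow> real" where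
  "U x = exp (- q * Z ((norm x)\<^sup>2))"

text \<open>Inside the ball this is the chain rule for \<open>U\<close>, arranged in the form
  required by \<open>v_energy_radial_gradient\<close> with c = -q exp(-q Z).\<close>

definition grad_U :: "'a::real_normed_vector \<Rightarrow> 'a" where
  "grad_U x = (2 * ((- q * exp (- q * Z ((norm x)\<^sup>2))) * Z' ((norm x)\<^sup>2))) *\<^sub>R x"

lemma w_energy_U:
  assumes n_eq: "n = CARD('n::finite)"
  shows "weighted_energy p {x::real^'n. norm x < lam} (w_weight \<alpha> \<beta> p lam) U = ennreal (K * RI)"
proof -
  have "weighted_energy p {x::real^'n. norm x < lam} (w_weight \<alpha> \<beta> p lam) U
      = (\<integral>\<^sup>+r. ennreal (K * (exp (a * T r) / (r * g r)) * \<bar>exp (- q * Z (r\<^sup>2))\<bar> powr p)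
        * indicator {0<..<lam} r \<partial>lborel)"
    unfolding U_def[abs_def]
    by (rule w_energy_eq[OF n_eq, where h = "\<lambda>r. exp (- q * Z (r\<^sup>2))"]) measurable
  also have "\<dots> = (\<integral>\<^sup>+r. ennreal (K * e r) * indicator {0<..<lam} r \<partial>lborel)"
    by (intro nn_integral_cong)
       (auto simp: indicator_def Z_square mult.assoc simp flip: exp_minus_ramp_powr)
  also have "\<dots> = ennreal (LINT r:{0<..<lam}|lborel. K * e r)"
    using K_pos e_pos e_integrable
    by (intro nn_integral_eq_set_integral set_integrable_mult_right) (auto intro!: mult_nonneg_nonneg less_imp_le)
  finally show ?thesis by (simp add: RI_def)
qed

lemma v_energy_grad_U:
  assumes n_eq: "n = CARD('n::finite)"
  shows "weighted_energy p {x::real^'n. norm x < lam} (v_weight \<alpha> \<beta> p lam) grad_U = ennreal (K * LI)"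
proof -
  let ?c = "\<lambda>r. - q * exp (- q * Z (r\<^sup>2))"
  have "weighted_energy p {x::real^'n. norm x < lam} (v_weight \<alpha> \<beta> p lam) grad_U
      = weighted_energy p {x::real^'n. norm x < lam} (w_weight \<alpha> \<beta> p lam)
        (\<lambda>x. ?c (norm x) * ramp' (T (norm x)))"
    unfolding grad_U_def[abs_def] by (rule v_energy_radial_gradient[OF n_eq])
  also have "\<dots> = (\<integral>\<^sup>+r. ennreal (K * (exp (a * T r) / (r * g r)) * \<bar>?c r * ramp' (T r)\<bar> powr p)
        * indicator {0<..<lam} r \<partial>lborel)"
    by (rule w_energy_eq[OF n_eq, where h = "\<lambda>r. ?c r * ramp' (T r)"]) measurable
  also have "\<dots> = (\<integral>\<^sup>+r. ennreal (K * ((q * ramp' (T r)) powr p * e r)) * indicator {0<..<lam} r \<partial>lborel)"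
  proof (intro nn_integral_cong)
    fix r
    have "K * (exp (a * T r) / (r * g r)) * \<bar>?c r * ramp' (T r)\<bar> powr p = K * ((q * ramp' (T r)) powr p * e r)"
      if "0 < r"
    proof -
      have "\<bar>?c r * ramp' (T r)\<bar> = (q * ramp' (T r)) * exp (- q * ramp (T r))"
        using q_pos ramp'_bounds[of "T r"] that by (simp add: Z_square abs_mult)
      then have "\<bar>?c r * ramp' (T r)\<bar> powr p = (q * ramp' (T r)) powr p * exp (- q * ramp (T r)) powr p"
        using q_pos ramp'_bounds[of "T r"] by (simp only:) (simp add: powr_mult)
      then show ?thesis unfolding exp_minus_ramp_powr[symmetric] by (simp only: mult_ac)
    qed
    then show "ennreal (K * (exp (a * T r) / (r * g r)) * \<bar>?c r * ramp' (T r)\<bar> powr p) * indicator {0<..<lam} r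
        = ennreal (K * ((q * ramp' (T r)) powr p * e r)) * indicator {0<..<lam} r"
      by (auto simp: indicator_def)
  qed
  also have "\<dots> = ennreal (LINT r:{0<..<lam}|lborel. K * ((q * ramp' (T r)) powr p * e r))"
    using K_pos e_pos LI_integrable powr_ramp'_bounds
    by (intro nn_integral_eq_set_integral set_integrable_mult_right mult_nonneg_nonneg) (auto intro: less_imp_le)
  finally show ?thesis by (simp add: LI_def)
qed

lemma H_radial_tendsto:
  assumes "norm (x::real^'n) < lam"
  shows "(\<lambda>j. H j (x \<bullet> x)) \<longlonglongrightarrow> U x"
proof -
  have "x \<bullet> x < lam\<^sup>2" using assms lam by (simp add: dot_square_norm power_strict_mono)
  moreover have "(\<lambda>j. exp (- q * Z (x \<bullet> x)) * cutoff (real j - Z (x \<bullet> x))) \<longlonglongrightarrow> exp (- q * Z (x \<bullet> x)) * 1"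
    by (intro tendsto_intros cutoff_tendsto_1)
  ultimately show ?thesis by (simp add: H_def Q_def U_def dot_square_norm)
qed

lemma grad_H_minus_grad_U:
  assumes "norm (x::real^'n) < lam"
  shows "grad (\<lambda>x. H j (x \<bullet> x)) x - grad_U x
    = (2 * ((Q' j (Z ((norm x)\<^sup>2)) + q * exp (- q * Z ((norm x)\<^sup>2))) * Z' ((norm x)\<^sup>2))) *\<^sub>R x"
proof -
  have "x \<bullet> x < lam\<^sup>2" using assms lam by (simp add: dot_square_norm power_strict_mono)
  from grad_radial[OF H_has_derivative[OF this]] show ?thesis
    by (simp add: grad_U_def dot_square_norm algebra_simps)
qed

lemma Q'_difference: "Q' j z + q * exp (- q * z) = exp (- q * z) * (q * (1 - cutoff (real j - z)) - cutoff' (real j - z))"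
  by (simp add: Q'_def algebra_simps)

text \<open>The bound is uniform in j: after factoring out exp(-q z), a term in [0, q] and a term in
  [0, 2] are subtracted.\<close>

lemma Q'_difference_bound: "\<bar>Q' j z + q * exp (- q * z)\<bar> \<le> (q + 2) * exp (- q * z)"
proof -
  let ?t = "real j - z"
  have "0 \<le> q * (1 - cutoff ?t)" "q * (1 - cutoff ?t) \<le> q"
    using q_pos cutoff_bounds[of ?t] by (auto intro!: mult_left_le)
  then have "\<bar>q * (1 - cutoff ?t) - cutoff' ?t\<bar> \<le> q + 2"
    using cutoff'_bounds[of ?t] by linarith
  from mult_right_mono[OF this, of "exp (- q * z)"] show ?thesis
    unfolding Q'_difference abs_mult by (simp add: mult.commute)
qed

lemma Q'_difference_tendsto: "(\<lambda>j. Q' j z + q * exp (- q * z)) \<longlonglongrightarrow> 0"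
proof -
  have "(\<lambda>j. exp (- q * z) * (q * (1 - cutoff (real j - z)) - cutoff' (real j - z)))
      \<longlonglongrightarrow> exp (- q * z) * (q * (1 - 1) - 0)"
    by (intro tendsto_intros cutoff_tendsto_1 cutoff'_tendsto_0)
  then show ?thesis unfolding Q'_difference by simp
qed

text \<open>The error gradients reduce to one-dimensional integrals with the common majorant
  \<open>K * (q + 2) powr p * e r\<close>, and their integrands tend to 0 at every radius.\<close>

lemma v_energy_difference_tendsto:
  assumes n_eq: "n = CARD('n::finite)"
  shows "(\<lambda>j. weighted_energy p {x::real^'n. norm x < lam} (v_weight \<alpha> \<beta> p lam)
      (\<lambda>x. grad (\<lambda>x. H j (x \<bullet> x)) x - grad_U x)) \<longlonglongrightarrow> 0"
proof -
  define d where "d j r = Q' j (Z (r\<^sup>2)) + q * exp (- q * Z (r\<^sup>2))" for j r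
  have d_meas [measurable]: "d j \<in> borel_measurable borel" for j
    unfolding d_def[abs_def] by measurable
  let ?f = "\<lambda>j r. ennreal (K * (exp (a * T r) / (r * g r)) * \<bar>d j r * ramp' (T r)\<bar> powr p) * indicator {0<..<lam} r"
  have "weighted_energy p {x::real^'n. norm x < lam} (v_weight \<alpha> \<beta> p lam)
      (\<lambda>x. grad (\<lambda>x. H j (x \<bullet> x)) x - grad_U x) = integral\<^sup>N lborel (?f j)" for j
  proof -
    have "weighted_energy p {x::real^'n. norm x < lam} (v_weight \<alpha> \<beta> p lam)
        (\<lambda>x. grad (\<lambda>x. H j (x \<bullet> x)) x - grad_U x)
      = weighted_energy p {x::real^'n. norm x < lam} (v_weight \<alpha> \<beta> p lam)
        (\<lambda>x. (2 * (d j (norm x) * Z' ((norm x)\<^sup>2))) *\<^sub>R x)"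
      by (intro weighted_energy_cong) (simp add: grad_H_minus_grad_U d_def)
    also have "\<dots> = weighted_energy p {x::real^'n. norm x < lam} (w_weight \<alpha> \<beta> p lam)
        (\<lambda>x. d j (norm x) * ramp' (T (norm x)))"
      by (rule v_energy_radial_gradient[OF n_eq])
    also have "\<dots> = integral\<^sup>N lborel (?f j)"
      by (rule w_energy_eq[OF n_eq, where h = "\<lambda>r. d j r * ramp' (T r)"]) measurable
    finally show ?thesis .
  qed
  moreover have "(\<lambda>j. integral\<^sup>N lborel (?f j)) \<longlonglongrightarrow> (\<integral>\<^sup>+r. 0 \<partial>(lborel :: real measure))"
  proof (rule nn_integral_dominated_convergence)
    show "?f j \<in> borel_measurable lborel" for j by measurable
    show "(\<lambda>r. ennreal (K * (q + 2) powr p * e r) * indicator {0<..<lam} r) \<in> borel_measurable lborel"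
      by measurable
    have "(\<integral>\<^sup>+r. ennreal (K * (q + 2) powr p * e r) * indicator {0<..<lam} r \<partial>lborel)
        = ennreal (LINT r:{0<..<lam}|lborel. K * (q + 2) powr p * e r)"
      using K_pos e_pos e_integrable
      by (intro nn_integral_eq_set_integral set_integrable_mult_right mult_nonneg_nonneg) (auto intro: less_imp_le)
    then show "(\<integral>\<^sup>+r. ennreal (K * (q + 2) powr p * e r) * indicator {0<..<lam} r \<partial>lborel) < \<infinity>"
      by simp
    show "AE r in lborel. ?f j r \<le> ennreal (K * (q + 2) powr p * e r) * indicator {0<..<lam} r" for j
    proof (intro AE_I2)
      fix r
      have "K * (exp (a * T r) / (r * g r)) * \<bar>d j r * ramp' (T r)\<bar> powr p \<le> K * (q + 2) powr p * e r"
        if r: "0 < r" "r < lam"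
      proof -
        \<comment> \<open>The first factor comes from \<open>Q'_difference_bound\<close>, the second
          from the slope bound of \<open>ramp\<close>.\<close>
        have "\<bar>d j r * ramp' (T r)\<bar> \<le> ((q + 2) * exp (- q * ramp (T r))) * 1"
          unfolding abs_mult d_def Z_square[OF r(1)]
          using Q'_difference_bound ramp'_bounds[of "T r"] q_pos by (intro mult_mono) auto
        then have "\<bar>d j r * ramp' (T r)\<bar> powr p \<le> ((q + 2) * exp (- q * ramp (T r))) powr p"
          using p by (intro powr_mono2) auto
        also have "\<dots> = (q + 2) powr p * exp (- q * ramp (T r)) powr p"
          using q_pos by (simp add: powr_mult)
        finally have "K * (exp (a * T r) / (r * g r)) * \<bar>d j r * ramp' (T r)\<bar> powr p
            \<le> K * (exp (a * T r) / (r * g r)) * ((q + 2) powr p * exp (- q * ramp (T r)) powr p)"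
          using K_pos r g_pos[OF r] by (intro mult_left_mono) auto
        then show ?thesis unfolding exp_minus_ramp_powr[symmetric] by (simp only: mult_ac)
      qed
      then show "?f j r \<le> ennreal (K * (q + 2) powr p * e r) * indicator {0<..<lam} r"
        by (auto simp: indicator_def intro!: ennreal_leI)
    qed
    show "AE r in lborel. (\<lambda>j. ?f j r) \<longlonglongrightarrow> 0"
    proof (intro AE_I2)
      fix r
      have "(\<lambda>j. d j r * ramp' (T r)) \<longlonglongrightarrow> 0"
        unfolding d_def by (intro tendsto_mult_left_zero Q'_difference_tendsto)
      then have "(\<lambda>j. \<bar>d j r * ramp' (T r)\<bar> powr p) \<longlonglongrightarrow> 0"
        using p by (intro tendsto_zero_powrI[OF tendsto_rabs_zero tendsto_const]) auto
      then have "(\<lambda>j. K * (exp (a * T r) / (r * g r)) * \<bar>d j r * ramp' (T r)\<bar> powr p) \<longlonglongrightarrow> 0"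
        by (rule tendsto_mult_right_zero)
      from tendsto_ennrealI[OF this] show "(\<lambda>j. ?f j r) \<longlonglongrightarrow> 0"
        by (cases "r \<in> {0<..<lam}") auto
    qed
  qed simp
  ultimately show ?thesis by simp
qed

lemma U_has_W0_gradient:
  assumes n_eq: "n = CARD('n::finite)"
  shows "has_W0_gradient p {x::real^'n. norm x < lam} (v_weight \<alpha> \<beta> p lam) U grad_U"
  unfolding has_W0_gradient_def
proof (intro conjI exI[of _ "\<lambda>j x. H j (x \<bullet> x)"] allI)
  show "U \<in> borel_measurable (lebesgue_on {x::real^'n. norm x < lam})"
    unfolding U_def[abs_def] by (intro measurable_restrict_space1 measurable_completion) measurable
  show "grad_U \<in> borel_measurable (lebesgue_on {x::real^'n. norm x < lam})"
    unfolding grad_U_def[abs_def] by (intro measurable_restrict_space1 measurable_completion) measurable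
  show "AE x in lebesgue_on {x::real^'n. norm x < lam}. (\<lambda>j. H j (x \<bullet> x)) \<longlonglongrightarrow> U x"
    using H_radial_tendsto by (intro AE_I2) (auto simp: space_restrict_space)
qed (use H_in_Cc_infinity v_energy_difference_tendsto[OF n_eq] in auto)

end

theorem theorem3p2:
  fixes \<alpha> \<beta> p lam \<gamma> \<epsilon> :: real and \<Omega> :: "(real^'n) set"
  assumes "CARD('n) \<ge> 2"
    and "lam > 0"
    and "\<Omega> = {x. norm x < lam}"
    and "p > 1"
    and "\<beta> * p > 1"
    and "\<alpha> * p \<le> real CARD('n) + \<beta> * p - 1"
    and "\<gamma> = (\<beta> * p - 1) / p"
    and "0 < \<epsilon>" and "\<epsilon> < 1"
  shows "\<exists>u \<in> W0_space p \<Omega> (v_weight \<alpha> \<beta> p lam). \<exists>G.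
           has_W0_gradient p \<Omega> (v_weight \<alpha> \<beta> p lam) u G \<and>
           (let L = weighted_energy p \<Omega> (v_weight \<alpha> \<beta> p lam) G;
                R = weighted_energy p \<Omega> (w_weight \<alpha> \<beta> p lam) u
            in 0 < R \<and> R < \<infinity> \<and>
               ennreal (\<gamma> powr p) \<le> L / R \<and>
               L / R \<le> ennreal ((1 + \<epsilon>) powr p * \<gamma> powr p))"
proof -
  interpret hw: hardy_weights "CARD('n)" \<alpha> \<beta> p lam \<epsilon>
    using assms by unfold_locales auto
  have \<gamma>: "hw.\<gamma> = \<gamma>" using assms(7) by (simp add: hw.\<gamma>_def hw.a_def)
  have W: "has_W0_gradient p \<Omega> (v_weight \<alpha> \<beta> p lam) hw.U hw.grad_U"
    unfolding assms(3) by (rule hw.U_has_W0_gradient) simp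
  have L: "weighted_energy p \<Omega> (v_weight \<alpha> \<beta> p lam) hw.grad_U = ennreal (hw.K * hw.LI)"
    unfolding assms(3) by (rule hw.v_energy_grad_U) simp
  have R: "weighted_energy p \<Omega> (w_weight \<alpha> \<beta> p lam) hw.U = ennreal (hw.K * hw.RI)"
    unfolding assms(3) by (rule hw.w_energy_U) simp
  have pos: "0 < hw.K" "0 < hw.RI" by (rule hw.K_pos hw.RI_pos)+
  have lower: "\<gamma> powr p * hw.RI \<le> hw.LI" using hw.LI_lower \<gamma> by simp
  \<comment> \<open>Since q = \<gamma> (1 + \<epsilon>), the constant of the one-dimensional upper
    bound is the required one.\<close>
  have "hw.q powr p = (1 + \<epsilon>) powr p * \<gamma> powr p"
    using hw.gamma_pos assms(8) by (simp add: hw.q_def \<gamma> powr_mult)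
  then have upper: "hw.LI \<le> (1 + \<epsilon>) powr p * \<gamma> powr p * hw.RI" using hw.LI_upper by simp
  have LI0: "0 \<le> hw.LI" using lower pos by (smt (verit) mult_nonneg_nonneg powr_ge_zero)
  \<comment> \<open>The common factor \<open>K\<close> cancels, and the quotient of extended reals
    becomes a real one.\<close>
  have "ennreal (hw.K * hw.LI) / ennreal (hw.K * hw.RI) = ennreal (hw.LI / hw.RI)"
    using pos LI0 by (subst divide_ennreal) auto
  moreover have "\<gamma> powr p \<le> hw.LI / hw.RI" "hw.LI / hw.RI \<le> (1 + \<epsilon>) powr p * \<gamma> powr p"
    using lower upper pos by (simp_all add: field_simps)
  ultimately show ?thesis
    using W pos unfolding W0_space_def
    by (intro bexI[of _ hw.U] exI[of _ hw.grad_U]) (auto simp: Let_def L R ennreal_leI)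
qed

end
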